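(* Let $E$ be a countable measure-preserving Borel equivalence relation on a standard probability space $(X,\mathcal B,\mu)$. Then every doubly stochastic element $\Phi$ (of any multiplicity $n\geq 1$) in $[[E]]$ is almost decomposable; that is, for every $\varepsilon>0$ there exists a decomposable doubly stochastic element $\Psi$ in $[[E]]$, of the same multiplicity as $\Phi$, with $d(\Phi,\Psi)<\varepsilon$.
   Context: $(X,\mathcal B,\mu)$ is a standard probability space and $E\subset X\times X$ is a Borel equivalence relation with countable classes that is measure preserving (every measurable bijection between measurable subsets of $X$ whose graph is contained in $E$ preserves $\mu$). All equalities of sets and functions are modulo null sets; $\mathbb N$ contains $0$. $[E]$ is the set of measurable bijections $\theta:X\to X$ with $\mathrm{graph}(\theta)\subset E$; $[[E]]$ is the set of measurable bijections $\varphi:A\to B$ between measurable subsets $A,B\subset X$ with $\mathrm{graph}(\varphi)=\{(x,\varphi(x)):x\in A\}\subset E$. The counting measure on $E$ is $\nu(C)=\int_X \mathrm{Card}(C\cap(\{x\}\times X))\,d\mu(x)=\int_X \mathrm{Card}(C\cap(X\times\{x\}))\,d\mu(x)$. A doubly stochastic element (DSE) of multiplicity $n\ge 1$ is a finite family $\Phi=\{\varphi_i:A_i\to B_i\}_i$ of elements of $[[E]]$ with $\sum_i\chi_{A_i}=n$ and $\sum_i\chi_{B_i}=n$ (constant functions on $X$). Its associated matrix is $M(\Phi)=\sum_i\chi_{\mathrm{graph}(\varphi_i)}:E\to\mathbb N$. For two DSEs of the same multiplicity, $d(\Phi,\Psi)=\int_E|M(\Phi)-M(\Psi)|\,d\nu$.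 A DSE $\Phi$ of multiplicity $n$ is decomposable if there exist $\theta_1,\dots,\theta_n\in[E]$ with $M(\Phi)=\sum_{j=1}^n\chi_{\mathrm{graph}(\theta_j)}$. *)

theory Defs
  imports "HOL-Probability.Probability"
begin

text \<open>
  A standard probability space: a probability measure on the Borel sets of a Polish space. The
  topology is an abstract one on \<open>space M\<close>, so that \<open>X\<close> need not be a whole type.
\<close>

definition standard_prob_space :: "'a measure \<Rightarrow> bool" where
  "standard_prob_space M \<longleftrightarrow> prob_space M \<and>
    (\<exists>T. completely_metrizable_space T \<and> second_countable T \<and> topspace T = space M \<and>
         sets M = sigma_sets (space M) {U. openin T U})"

definition countable_borel_equiv_rel :: "'a measure \<Rightarrow> ('a \<times> 'a) set \<Rightarrow> bool" where
  "countable_borel_equiv_rel M E \<longleftrightarrow>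
    E \<in> sets (M \<Otimes>\<^sub>M M) \<and> equiv (space M) E \<and> (\<forall>x\<in>space M. countable (E `` {x}))"

text \<open>
  \<open>[[E]]\<close>. A bijection \<open>A \<rightarrow> B\<close> is a partial map with \<open>dom = A\<close> and \<open>ran = B\<close>. Only measurability
  of the map itself is asked for; in a standard Borel space its inverse is then measurable too.
\<close>

definition full_pseudogroup :: "'a measure \<Rightarrow> ('a \<times> 'a) set \<Rightarrow> ('a \<rightharpoonup> 'a) set" where
  "full_pseudogroup M E = {\<phi>. dom \<phi> \<in> sets M \<and> ran \<phi> \<in> sets M \<and> inj_on \<phi> (dom \<phi>) \<and>
     (\<lambda>x. the (\<phi> x)) \<in> measurable (restrict_space M (dom \<phi>)) (restrict_space M (ran \<phi>)) \<and>
     Map.graph \<phi> \<subseteq> E}"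

text \<open>\<open>[E]\<close>\<close>

definition full_group :: "'a measure \<Rightarrow> ('a \<times> 'a) set \<Rightarrow> ('a \<rightharpoonup> 'a) set" where
  "full_group M E = {\<theta> \<in> full_pseudogroup M E. dom \<theta> = space M \<and> ran \<theta> = space M}"

definition measure_preserving_rel :: "'a measure \<Rightarrow> ('a \<times> 'a) set \<Rightarrow> bool" where
  "measure_preserving_rel M E \<longleftrightarrow>
    (\<forall>\<phi>\<in>full_pseudogroup M E. \<forall>C\<in>sets M. C \<subseteq> ran \<phi> \<longrightarrow>
       emeasure M {x \<in> dom \<phi>. the (\<phi> x) \<in> C} = emeasure M C)"

text \<open>
  The counting measure \<open>\<nu>\<close> on \<open>E\<close>. For a Borel relation with countable classes on a standard
  space, the integrand is a measurable function of \<open>x\<close> (Lusin--Novikov), so the set function below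
  is countably additive and \<^const>\<open>measure_of\<close> yields a measure with exactly these values.
\<close>

definition rel_measure :: "'a measure \<Rightarrow> ('a \<times> 'a) set \<Rightarrow> ('a \<times> 'a) measure" where
  "rel_measure M E = measure_of E {C \<in> sets (M \<Otimes>\<^sub>M M). C \<subseteq> E}
     (\<lambda>C. \<integral>\<^sup>+x. emeasure (count_space UNIV) (C \<inter> ({x} \<times> space M)) \<partial>M)"

text \<open>
  Finite families are lists. Elements of \<open>[[E]]\<close> are genuine partial maps, while equalities of
  functions on \<open>X\<close> and on \<open>E\<close> hold almost everywhere.
\<close>

definition doubly_stochastic ::
  "'a measure \<Rightarrow> ('a \<times> 'a) set \<Rightarrow> nat \<Rightarrow> ('a \<rightharpoonup> 'a) list \<Rightarrow> bool" where
  "doubly_stochastic M E n \<Phi> \<longleftrightarrow> n \<ge> 1 \<and> set \<Phi> \<subseteq> full_pseudogroup M E \<and>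
     (AE x in M. (\<Sum>\<phi>\<leftarrow>\<Phi>. indicator (dom \<phi>) x) = n) \<and>
     (AE x in M. (\<Sum>\<phi>\<leftarrow>\<Phi>. indicator (ran \<phi>) x) = n)"

definition dse_matrix :: "('a \<rightharpoonup> 'a) list \<Rightarrow> 'a \<times> 'a \<Rightarrow> nat" where
  "dse_matrix \<Phi> z = (\<Sum>\<phi>\<leftarrow>\<Phi>. indicator (Map.graph \<phi>) z)"

definition dse_dist ::
  "'a measure \<Rightarrow> ('a \<times> 'a) set \<Rightarrow> ('a \<rightharpoonup> 'a) list \<Rightarrow> ('a \<rightharpoonup> 'a) list \<Rightarrow> ennreal" where
  "dse_dist M E \<Phi> \<Psi> =
     (\<integral>\<^sup>+z. ennreal \<bar>real (dse_matrix \<Phi> z) - real (dse_matrix \<Psi> z)\<bar> \<partial>rel_measure M E)"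

definition decomposable_dse ::
  "'a measure \<Rightarrow> ('a \<times> 'a) set \<Rightarrow> nat \<Rightarrow> ('a \<rightharpoonup> 'a) list \<Rightarrow> bool" where
  "decomposable_dse M E n \<Phi> \<longleftrightarrow> doubly_stochastic M E n \<Phi> \<and>
     (\<exists>\<theta>. (\<forall>j\<in>{1..n}. \<theta> j \<in> full_group M E) \<and>
        (AE z in rel_measure M E. dse_matrix \<Phi> z = (\<Sum>j=1..n. indicator (Map.graph (\<theta> j)) z)))"

end

theory Submission
  imports Defs
begin

text \<open>
  View \<open>\<Phi>\<close> as a bipartite multigraph on two copies of \<open>X\<close> in which all degrees are \<open>n\<close>, and colour
  its edges with \<open>n\<close> colours as in Koenig's edge colouring theorem. An uncoloured edge \<open>(x, y)\<close> has a
  colour \<open>a\<close> missing at \<open>x\<close> and a colour \<open>b\<close> missing at \<open>y\<close>. The \<open>a\<close>-\<open>b\<close>-alternating path starting at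
  \<open>y\<close> never reaches \<open>x\<close>, so if it is finite, swapping \<open>a\<close> and \<open>b\<close> along it frees the colour \<open>a\<close> for
  \<open>(x, y)\<close>. For fixed \<open>a\<close>, \<open>b\<close> and a fixed member of \<open>\<Phi>\<close> different edges give different paths, and all
  paths of length at most \<open>L\<close> can be swapped at once; hence their starting points have small measure
  if the mass of uncoloured edges is nearly minimal. The starting points of longer paths have \<open>L + 1\<close>
  disjoint images under a partial isomorphism, hence measure at most \<open>1 / (L + 1)\<close>. So almost
  all edges can be coloured. Every colour class \<open>\<alpha>\<close> is an almost everywhere defined element of \<open>[[E]]\<close>;
  sending the end of each maximal \<open>\<alpha>\<close>-chain back to its start extends it to an element of \<open>[E]\<close>.
\<close>

section \<open>Probability measures on Polish spaces\<close>

locale polish_prob_space = prob_space M for M :: "'a measure" +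
  fixes T :: "'a topology"
  assumes cm: "completely_metrizable_space T"
    and second_countable: "second_countable T"
    and topspace_eq: "topspace T = space M"
    and sets_eq: "sets M = sigma_sets (space M) {U. openin T U}"
begin

section \<open>Regularity, tightness and Lusin's theorem\<close>

lemma openin_sets: "openin T U \<Longrightarrow> U \<in> sets M"
  unfolding sets_eq by (rule sigma_sets.Basic) simp

lemma closedin_sets: "closedin T C \<Longrightarrow> C \<in> sets M"
  by (metis closedin_def openin_sets sets.Diff sets.top double_diff topspace_eq order_refl)

lemma Hausdorff: "Hausdorff_space T"
  using cm completely_metrizable_imp_metrizable_space metrizable_imp_Hausdorff_space by blast

text \<open>Continuity from below. It replaces a countable union by a finite one, which stays closed
  when its members are closed.\<close>

lemma eventually_covered:
  fixes A :: "nat \<Rightarrow> 'a set"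
  assumes A: "range A \<subseteq> sets M" and e: "(e::real) > 0"
  shows "\<exists>m. measure M ((\<Union>i. A i) - (\<Union>i<m. A i)) < e"
proof -
  define B where "B = (\<lambda>m. \<Union>i<m. A i)"
  have Bs: "range B \<subseteq> sets M" unfolding B_def using A by auto
  have inc: "incseq B" unfolding B_def incseq_def by fastforce
  have un: "(\<Union>m. B m) = (\<Union>i. A i)" unfolding B_def by auto
  have "(\<lambda>m. measure M (B m)) \<longlonglongrightarrow> measure M (\<Union>i. A i)"
    using finite_Lim_measure_incseq[OF Bs inc] by (simp add: un)
  then obtain m where m: "\<bar>measure M (B m) - measure M (\<Union>i. A i)\<bar> < e"
    using e by (auto dest!: LIMSEQ_D)
  have "measure M ((\<Union>i. A i) - B m) = measure M (\<Union>i. A i) - measure M (B m)"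
    using A Bs by (intro finite_measure_Diff) (auto simp: B_def image_subset_iff)
  then show ?thesis using m unfolding B_def by (intro exI[of _ m]) auto
qed

text \<open>The bounds sum to \<open>e / 2\<close>, which leaves half of the tolerance for a second
  error term.\<close>

lemma measure_UN_less:
  assumes A: "range A \<subseteq> sets M" and e: "(e::real) > 0"
    and le: "\<And>i::nat. measure M (A i) < e / 2 ^ (i + 2)"
  shows "measure M (\<Union>i. A i) \<le> e / 2"
proof -
  have s: "(\<lambda>i. e / 2 ^ (i + 2)) sums (e / 2)"
    using sums_mult[OF power_half_series, of "e/2"] by (simp add: field_simps power_divide)
  have sm: "summable (\<lambda>i. measure M (A i))"
    using sums_summable[OF s] le by (intro summable_comparison_test[OF _ sums_summable[OF s]]) (auto intro!: exI[of _ 0] less_imp_le)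
  have "measure M (\<Union>i. A i) \<le> (\<Sum>i. measure M (A i))"
    by (rule finite_measure_subadditive_countably[OF A sm])
  also have "\<dots> \<le> (\<Sum>i. e / 2 ^ (i + 2))"
    using le sm sums_summable[OF s] by (intro suminf_le) (auto intro: less_imp_le)
  also have "\<dots> = e / 2" using s by (simp add: sums_iff)
  finally show ?thesis .
qed

text \<open>Induction over the generated sigma-algebra. Open sets are F-sigma by metrizability,
  complements exchange the inner and the outer approximation, and in a countable union the errors
  are summed geometrically.\<close>

lemma regular:
  assumes "A \<in> sets M" "(e::real) > 0"
  shows "\<exists>F U. closedin T F \<and> openin T U \<and> F \<subseteq> A \<and> A \<subseteq> U \<and> measure M (U - F) < e"
proof -
  have "A \<in> sigma_sets (space M) {U. openin T U}" using assms sets_eq by auto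
  then show ?thesis using assms(2)
  proof (induction arbitrary: e rule: sigma_sets.induct)
    case (Basic a)
    then have "fsigma_in T a"
      using open_imp_fsigma_in cm completely_metrizable_imp_metrizable_space by blast
    then obtain C where C: "\<And>n. closedin T (C n)" "\<And>n::nat. C n \<subseteq> C (Suc n)" "\<Union> (range C) = a"
      by (auto simp: fsigma_in_ascending)
    obtain m where m: "measure M ((\<Union>i. C i) - (\<Union>i<m. C i)) < e"
      using eventually_covered[of C e] C(1) closedin_sets Basic by auto
    have "closedin T (\<Union>i<m. C i)" using C(1) by (intro closedin_Union) auto
    then show ?case using Basic C m by - (rule exI[of _ "\<Union>i<m. C i"], rule exI[of _ a], auto)
  next
    case Empty
    then show ?case by (intro exI[of _ "{}"]) auto
  next
    case (Compl a)
    then obtain F U where *: "closedin T F" "openin T U" "F \<subseteq> a" "a \<subseteq> U" "measure M (U - F) < e"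
      using Compl.IH[OF Compl.prems] by metis
    have "U \<subseteq> space M" using * openin_subset topspace_eq by metis
    then have "(space M - F) - (space M - U) = U - F" by auto
    then show ?case using *
      by - (rule exI[of _ "space M - U"], rule exI[of _ "space M - F"], (auto simp: topspace_eq[symmetric]))
  next
    case (Union a)
    have "\<forall>i. \<exists>F U. closedin T F \<and> openin T U \<and> F \<subseteq> a i \<and> a i \<subseteq> U \<and> measure M (U - F) < e / 2 ^ (i + 2)"
      using Union by simp
    then obtain F U where FU: "\<And>i. closedin T (F i)" "\<And>i. openin T (U i)" "\<And>i. F i \<subseteq> a i"
       "\<And>i. a i \<subseteq> U i" "\<And>i. measure M (U i - F i) < e / 2 ^ (i + 2)" by metis
    have sets: "\<And>i. F i \<in> sets M" "\<And>i. U i \<in> sets M" using FU closedin_sets openin_sets by auto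
    \<comment> \<open>An infinite union of closed sets need not be closed, so the inner
      approximation is truncated; the outer one is not.\<close>
    obtain m where m: "measure M ((\<Union>i. F i) - (\<Union>i<m. F i)) < e / 2"
      using eventually_covered[of F "e/2"] sets Union by auto
    have 1: "measure M (\<Union>i. U i - F i) \<le> e / 2"
      using FU sets Union by (intro measure_UN_less) auto
    have "measure M ((\<Union>i. U i) - (\<Union>i<m. F i))
        \<le> measure M ((\<Union>i. U i - F i) \<union> ((\<Union>i. F i) - (\<Union>i<m. F i)))"
      using sets by (intro finite_measure_mono) auto
    also have "\<dots> \<le> measure M (\<Union>i. U i - F i) + measure M ((\<Union>i. F i) - (\<Union>i<m. F i))"
      using sets by (intro measure_Un_le) auto
    also have "\<dots> < e" using 1 m by simp
    finally have lt: "measure M ((\<Union>i. U i) - (\<Union>i<m. F i)) < e" .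
    have "(\<Union>i<m. F i) \<subseteq> \<Union> (range a)" "\<Union> (range a) \<subseteq> (\<Union>i. U i)" using FU(3,4) by blast+
    moreover have "closedin T (\<Union>i<m. F i)" "openin T (\<Union>i. U i)"
      using FU(1,2) by (auto intro!: closedin_Union)
    ultimately show ?case using lt by blast
  qed
qed

text \<open>Ulam's theorem. For every \<open>n\<close>, finitely many balls of radius
  \<open>1 / Suc n\<close> miss less than \<open>e / 2 ^ (n + 2)\<close>. The points that lie in all
  these finite unions form a totally bounded set, whose closure is compact by completeness.\<close>

lemma tight:
  assumes "(e::real) > 0"
  shows "\<exists>K. compactin T K \<and> measure M (space M - K) < e"
proof -
  obtain X d where X: "Metric_space X d" "Metric_space.mcomplete X d" "T = Metric_space.mtopology X d"
    using cm unfolding completely_metrizable_space_def by blast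
  interpret X: Metric_space X d by fact
  have Xs: "X = space M" using X topspace_eq by simp
  have "\<exists>B. (\<forall>k. \<exists>x\<in>X. B k = X.mball x (1 / Suc n)) \<and> (\<Union>k::nat. B k) = space M" for n :: nat
  proof -
    obtain V where V: "countable V" "V \<subseteq> (\<lambda>x. X.mball x (1 / Suc n)) ` X" "\<Union>V = topspace T"
      using Lindelof_spaceD[OF second_countable_imp_Lindelof_space[OF second_countable],
          of "(\<lambda>x. X.mball x (1 / Suc n)) ` X"] by (fastforce simp: X(3))
    have "V \<noteq> {}" using V not_empty topspace_eq by auto
    then have "range (from_nat_into V) = V" using V by (simp add: range_from_nat_into)
    then have "\<exists>x\<in>X. from_nat_into V k = X.mball x (1 / Suc n)" for k
    proof -
      have "from_nat_into V k \<in> V" using \<open>V \<noteq> {}\<close> by (rule from_nat_into)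
      then have "from_nat_into V k \<in> (\<lambda>x. X.mball x (1 / Suc n)) ` X" using V(2) by (rule subsetD[rotated])
      then show ?thesis by (rule imageE) (rule bexI)
    qed
    then show ?thesis using V(3) \<open>range (from_nat_into V) = V\<close>
      by (intro exI[of _ "from_nat_into V"] conjI allI) (simp_all add: topspace_eq)
  qed
  then obtain B where B: "\<And>n k. \<exists>x\<in>X. B n k = X.mball x (1 / Suc n)"
    "\<And>n. (\<Union>k::nat. B n k) = space M" by metis
  have Bs: "B n k \<in> sets M" for n k
    using B(1)[of n k] openin_sets X(3) by auto
  have "\<exists>m. measure M (space M - (\<Union>k<m. B n k)) < e / 2 ^ (n + 2)" for n
    using eventually_covered[of "B n" "e / 2 ^ (n + 2)"] Bs B(2) assms by auto
  then obtain m where m: "\<And>n. measure M (space M - (\<Union>k<m n. B n k)) < e / 2 ^ (n + 2)" by metis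
  define S where "S = (\<Inter>n. \<Union>k<m n. B n k)"
  have S1: "measure M (space M - S) \<le> e / 2"
  proof -
    have "space M - S = (\<Union>n. space M - (\<Union>k<m n. B n k))" unfolding S_def by auto
    moreover have "range (\<lambda>n. space M - (\<Union>k<m n. B n k)) \<subseteq> sets M" using Bs by auto
    ultimately show ?thesis using measure_UN_less[OF _ assms, of "\<lambda>n. space M - (\<Union>k<m n. B n k)"] m by metis
  qed
  have SX: "S \<subseteq> X" using B(2)[of 0] unfolding S_def Xs by blast
  have "X.mtotally_bounded S"
    unfolding X.mtotally_bounded_def
  proof (intro allI impI)
    fix r :: real assume "r > 0"
    then obtain n :: nat where n: "1 / Suc n < r / 2"
      by (metis half_gt_zero nat_approx_posE)
    \<comment> \<open>The net has to consist of points of \<open>S\<close>, but centres of balls may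
      lie outside. Each ball that meets \<open>S\<close> is represented by a point of
      \<open>S\<close>, which doubles the radius; hence \<open>r / 2\<close> above.\<close>
    define J where "J = {k. k < m n \<and> B n k \<inter> S \<noteq> {}}"
    define p where "p = (\<lambda>k. SOME x. x \<in> B n k \<inter> S)"
    have p: "p k \<in> B n k \<inter> S" if "k \<in> J" for k
    proof -
      have "\<exists>x. x \<in> B n k \<inter> S" using that unfolding J_def by blast
      then show ?thesis unfolding p_def by (rule someI_ex)
    qed
    show "\<exists>K. finite K \<and> K \<subseteq> S \<and> S \<subseteq> (\<Union>x\<in>K. X.mball x r)"
    proof (intro exI conjI)
      show "finite (p ` J)" unfolding J_def by auto
      show "p ` J \<subseteq> S" using p by auto
      show "S \<subseteq> (\<Union>x\<in>p ` J. X.mball x r)"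
      proof
        fix y assume y: "y \<in> S"
        then obtain k where k: "k < m n" "y \<in> B n k" unfolding S_def by blast
        then have "k \<in> J" using y unfolding J_def by auto
        obtain c where c: "c \<in> X" "B n k = X.mball c (1 / Suc n)" using B by blast
        have 1: "d c y < 1 / Suc n" "y \<in> X" "d c (p k) < 1 / Suc n" "p k \<in> X"
          using k p[OF \<open>k \<in> J\<close>] c by auto
        have "d (p k) y \<le> d (p k) c + d c y" using 1 c by (intro X.triangle) auto
        also have "\<dots> < r" using 1 n by (simp add: X.commute)
        finally show "y \<in> (\<Union>x\<in>p ` J. X.mball x r)" using 1 \<open>k \<in> J\<close> by auto
      qed
    qed
  qed
  then have K: "compactin T (T closure_of S)"
    using X.mtotally_bounded_eq_compact_closure_of[of S] X by simp
  have "S \<subseteq> T closure_of S" using SX by (intro closure_of_subset) (simp add: Xs topspace_eq)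
  then have "measure M (space M - T closure_of S) \<le> measure M (space M - S)"
    using Bs by (intro finite_measure_mono) (auto simp: S_def)
  then show ?thesis using S1 assms K by (intro exI[of _ "T closure_of S"]) auto
qed

lemma countable_base:
  obtains U :: "nat \<Rightarrow> 'a set" where "\<And>k. openin T (U k)"
    "\<And>V x. openin T V \<Longrightarrow> x \<in> V \<Longrightarrow> \<exists>k. x \<in> U k \<and> U k \<subseteq> V"
proof -
  obtain \<B> where \<B>: "countable \<B>" "\<And>V. V \<in> \<B> \<Longrightarrow> openin T V"
    "\<And>U x. openin T U \<Longrightarrow> x \<in> U \<Longrightarrow> \<exists>V \<in> \<B>. x \<in> V \<and> V \<subseteq> U"
    using second_countable[unfolded second_countable_def] by (elim exE conjE) (rule that, auto)
  \<comment> \<open>Adding the empty set makes the family nonempty, so that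
    \<open>from_nat_into\<close> enumerates all of it.\<close>
  define U where "U = from_nat_into (insert {} \<B>)"
  have r: "range U = insert {} \<B>" unfolding U_def using \<B> by (intro range_from_nat_into) auto
  show thesis
  proof (rule that[of U])
    show "openin T (U k)" for k using r \<B> by (metis insertE openin_empty rangeI)
    show "\<exists>k. x \<in> U k \<and> U k \<subseteq> V" if "openin T V" "x \<in> V" for V x
      using \<B>(3)[OF that] r by (metis insertI2 rangeE)
  qed
qed

text \<open>For each basic open \<open>U k\<close>, its preimage \<open>P k\<close> and the rest of
  \<open>A\<close> are approximated from inside by closed sets \<open>F k\<close> and
  \<open>G k\<close>. On the intersection of all \<open>F k \<union> G k\<close> the preimage of
  \<open>U k\<close> is the complement of \<open>G k\<close>, hence relatively open. Compactness
  comes from \<open>tight\<close>.\<close>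

lemma Lusin:
  assumes A: "A \<in> sets M" and f: "f \<in> measurable (restrict_space M A) M" and e: "(e::real) > 0"
  shows "\<exists>K. compactin T K \<and> K \<subseteq> A \<and> measure M (A - K) < e \<and> continuous_map (subtopology T K) T f"
proof -
  obtain U where U: "\<And>k::nat. openin T (U k)"
    "\<And>V x. openin T V \<Longrightarrow> x \<in> V \<Longrightarrow> \<exists>k. x \<in> U k \<and> U k \<subseteq> V"
    by (rule countable_base) blast
  have AM: "A \<subseteq> space M" using A sets.sets_into_space by auto
  define P where "P k = {x \<in> A. f x \<in> U k}" for k
  have P: "P k \<in> sets M" for k
  proof -
    have "f -` U k \<inter> space (restrict_space M A) \<in> sets (restrict_space M A)"
      using f openin_sets U by (intro measurable_sets) auto
    moreover have "f -` U k \<inter> space (restrict_space M A) = P k"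
      using AM by (auto simp: space_restrict_space P_def)
    ultimately show ?thesis using A by (simp add: sets_restrict_space_iff)
  qed
  have "\<exists>F G. closedin T F \<and> closedin T G \<and> F \<subseteq> P k \<and> G \<subseteq> A - P k \<and> measure M (A - (F \<union> G)) < (e/2) / 2 ^ (k + 2)" for k
  proof -
    \<comment> \<open>One half of \<open>e\<close> is reserved for \<open>tight\<close>, the other
      is spread over all \<open>k\<close>; the last factor 2 accounts for the two sets
      \<open>F\<close> and \<open>G\<close>.\<close>
    define r where "r = (e/2) / 2 ^ (k + 2) / 2"
    have r: "r > 0" using e unfolding r_def by simp
    obtain F U where 1: "closedin T F" "F \<subseteq> P k" "P k \<subseteq> U" "measure M (U - F) < r" "openin T U"
      using regular[OF P r] by metis
    obtain G V where 2: "closedin T G" "G \<subseteq> A - P k" "A - P k \<subseteq> V" "measure M (V - G) < r" "openin T V"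
      using regular[of "A - P k", OF _ r] A P by (metis sets.Diff)
    have "measure M (A - (F \<union> G)) \<le> measure M ((U - F) \<union> (V - G))"
      using 1 2 closedin_sets openin_sets by (intro finite_measure_mono) auto
    also have "\<dots> \<le> measure M (U - F) + measure M (V - G)"
      using 1 2 closedin_sets openin_sets by (intro measure_Un_le) auto
    also have "\<dots> < (e/2) / 2 ^ (k + 2)" using 1 2 unfolding r_def by linarith
    finally show ?thesis using 1 2 by metis
  qed
  then obtain F G where FG: "\<And>k. closedin T (F k)" "\<And>k. closedin T (G k)" "\<And>k. F k \<subseteq> P k"
    "\<And>k. G k \<subseteq> A - P k" "\<And>k. measure M (A - (F k \<union> G k)) < (e/2) / 2 ^ (k + 2)" by metis
  obtain K0 where K0: "compactin T K0" "measure M (space M - K0) < e/2"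
    using tight[of "e/2"] e by auto
  have K0s: "K0 \<in> sets M" using K0 closedin_sets compactin_imp_closedin Hausdorff by blast
  define K where "K = K0 \<inter> (\<Inter>k. F k \<union> G k)"
  have cl: "closedin T (\<Inter>k. F k \<union> G k)" using FG by (intro closedin_Inter) auto
  then have K: "compactin T K" unfolding K_def by (metis K0(1) compact_Int_closedin)
  have Fs: "F k \<in> sets M" "G k \<in> sets M" for k using FG closedin_sets by auto
  have KA: "K \<subseteq> A"
  proof -
    have "K \<subseteq> F 0 \<union> G 0" unfolding K_def by auto
    then show ?thesis using FG(3)[of 0] FG(4)[of 0] unfolding P_def by blast
  qed
  have "measure M (A - K) \<le> measure M ((space M - K0) \<union> (\<Union>k. A - (F k \<union> G k)))"
    using A K0s Fs AM by (intro finite_measure_mono) (auto simp: K_def)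
  also have "\<dots> \<le> measure M (space M - K0) + measure M (\<Union>k. A - (F k \<union> G k))"
    using A K0s Fs by (intro measure_Un_le) auto
  also have "measure M (\<Union>k. A - (F k \<union> G k)) \<le> (e/2)/2"
    using FG A Fs e by (intro measure_UN_less) auto
  finally have meas: "measure M (A - K) < e" using K0 e by linarith
  have KT: "K \<subseteq> topspace T" using KA AM topspace_eq by simp
  have "continuous_map (subtopology T K) T f"
    unfolding continuous_map_def
  proof (intro conjI allI impI)
    show "f \<in> topspace (subtopology T K) \<rightarrow> topspace T"
      using measurable_space[OF f] KA AM by (auto simp: topspace_eq space_restrict_space)
    fix V assume V: "openin T V"
    define J where "J = {k. U k \<subseteq> V}"
    have pre: "openin (subtopology T K) {x \<in> K. f x \<in> U k}" for k
    proof -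
      have "x \<in> F k \<union> G k" if "x \<in> K" for x using that unfolding K_def by auto
      then have "{x \<in> K. f x \<in> U k} = K - G k" using FG(3)[of k] FG(4)[of k] KA unfolding P_def by blast
      also have "\<dots> = K \<inter> (topspace T - G k)" using KT by auto
      also have "openin (subtopology T K) \<dots>"
        using FG(2) by (intro openin_subtopology_Int2) auto
      finally show ?thesis .
    qed
    have "{x \<in> topspace (subtopology T K). f x \<in> V} = (\<Union>k\<in>J. {x \<in> K. f x \<in> U k})"
      using U(2)[OF V] KT unfolding J_def by auto blast
    then show "openin (subtopology T K) {x \<in> topspace (subtopology T K). f x \<in> V}"
      using pre by auto
  qed
  then show ?thesis using K KA meas by blast
qed

section \<open>Images and graphs of measurable injections\<close>

text \<open>
  A measure-theoretic substitute for the Lusin--Souslin theorem: off a null set, a measurable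
  injection maps measurable sets to measurable sets.
\<close>

lemma conull_bimeasurable:
  assumes A: "A \<in> sets M" and f: "f \<in> measurable (restrict_space M A) M" and inj: "inj_on f A"
  shows "\<exists>D\<in>sets M. D \<subseteq> A \<and> measure M (A - D) = 0 \<and> (\<forall>C\<in>sets M. f ` (C \<inter> D) \<in> sets M)"
proof -
  have "\<forall>n::nat. \<exists>K. compactin T K \<and> K \<subseteq> A \<and> measure M (A - K) < 1 / Suc n \<and> continuous_map (subtopology T K) T f"
    using Lusin[OF A f] by simp
  then obtain K where K: "\<And>n::nat. compactin T (K n)" "\<And>n. K n \<subseteq> A" "\<And>n. measure M (A - K n) < 1 / Suc n"
     "\<And>n. continuous_map (subtopology T (K n)) T f" by metis
  have Ks: "K n \<in> sets M" for n using K closedin_sets compactin_imp_closedin Hausdorff by blast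
  have img: "compactin T (f ` C)" if "closedin T C" "C \<subseteq> K n" for n C
    using that K closed_compactin image_compactin compact_imp_compactin_subtopology by metis
  \<comment> \<open>Induction from the closed sets: their traces on \<open>K n\<close> are compact,
    so their images under the continuous \<open>f\<close> are compact. Injectivity lets images
    commute with complements.\<close>
  have im: "f ` (C \<inter> K n) \<in> sets M" if "C \<in> sets M" for C n
  proof -
    have "C \<in> sigma_sets (space M) {C. closedin T C}"
    proof -
      have "sigma_sets (space M) {U. openin T U} \<subseteq> sigma_sets (space M) {C. closedin T C}"
      proof (rule sigma_sets_mono, clarify)
        fix U assume U: "openin T U"
        then have "U = space M - (space M - U)" using openin_subset[OF U] topspace_eq by auto
        moreover have "space M - U \<in> {C. closedin T C}" using U by (simp add: topspace_eq[symmetric] closedin_diff)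
        ultimately show "U \<in> sigma_sets (space M) {C. closedin T C}"
          by (metis sigma_sets.Basic sigma_sets.Compl)
      qed
      then show ?thesis using that sets_eq by auto
    qed
    then show ?thesis
    proof (induction rule: sigma_sets.induct)
      case (Basic a)
      have "closedin T (a \<inter> K n)" using Basic K compactin_imp_closedin Hausdorff by blast
      from img[OF this, of n] have "compactin T (f ` (a \<inter> K n))" by auto
      then show ?case using closedin_sets compactin_imp_closedin Hausdorff by blast
    next
      case Empty
      then show ?case by simp
    next
      case (Compl a)
      have "f ` ((space M - a) \<inter> K n) = f ` (K n) - f ` (a \<inter> K n)"
        using inj K(2)[of n] A[THEN sets.sets_into_space] by (auto simp: inj_on_def) blast
      moreover have "f ` K n \<in> sets M"
        using img[of "K n" n] K closedin_sets compactin_imp_closedin Hausdorff by blast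
      ultimately show ?case using Compl by auto
    next
      case (Union a)
      have "f ` (\<Union> (range a) \<inter> K n) = (\<Union>i. f ` (a i \<inter> K n))" by auto
      then show ?case using Union by auto
    qed
  qed
  define D where "D = (\<Union>n. K n)"
  have "measure M (A - D) \<le> 1 / Suc n" for n
  proof -
    have "measure M (A - D) \<le> measure M (A - K n)"
      using A Ks by (intro finite_measure_mono) (auto simp: D_def)
    then show ?thesis using K(3)[of n] by simp
  qed
  then have "measure M (A - D) \<le> 0"
    by (metis linorder_not_less nat_approx_posE)
  moreover have "f ` (C \<inter> D) \<in> sets M" if "C \<in> sets M" for C
  proof -
    have "f ` (C \<inter> D) = (\<Union>n. f ` (C \<inter> K n))" unfolding D_def by auto
    then show ?thesis using im[OF that] by auto
  qed
  ultimately show ?thesis using K Ks by (intro bexI[of _ D]) (auto simp: D_def measure_le_0_iff)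
qed

text \<open>A countable base separates points, so the graph consists of the pairs over the domain
  such that, for every \<open>k\<close>, \<open>x\<close> is sent into \<open>U k\<close> exactly
  when \<open>y\<close> lies in \<open>U k\<close>. These are countably many measurable
  conditions.\<close>

lemma single_valued_sets:
  assumes sv: "single_valued R" and sub: "R \<subseteq> space M \<times> space M"
    and R: "\<And>S. S \<in> sets M \<Longrightarrow> R\<inverse> `` S \<in> sets M"
  shows "R \<in> sets (M \<Otimes>\<^sub>M M)"
proof -
  obtain U where U: "\<And>k::nat. openin T (U k)"
    "\<And>V x. openin T V \<Longrightarrow> x \<in> V \<Longrightarrow> \<exists>k. x \<in> U k \<and> U k \<subseteq> V"
    by (rule countable_base) blast
  define G where "G = (\<Inter>k. ((R\<inverse> `` space M) \<times> space M) \<inter>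
    ((R\<inverse> `` U k) \<times> U k \<union> (space M - R\<inverse> `` U k) \<times> (space M - U k)))"
  have UM: "U k \<in> sets M" for k using openin_sets[OF U(1)] .
  have "G \<in> sets (M \<Otimes>\<^sub>M M)"
    unfolding G_def using UM R
    by (intro sets.countable_INT') (auto intro!: pair_measureI sets.Int sets.Un sets.Diff)
  moreover have "R = G"
  proof (intro equalityI subsetI)
    fix z assume "z \<in> R"
    moreover obtain x y where z: "z = (x, y)" by (cases z)
    ultimately have xy: "(x, y) \<in> R" by simp
    then have "x \<in> space M" "y \<in> space M" using sub by auto
    moreover have "x \<in> R\<inverse> `` U k \<longleftrightarrow> y \<in> U k" for k using xy sv by (auto dest: single_valuedD)
    moreover have "x \<in> R\<inverse> `` space M" using xy calculation by auto
    ultimately show "z \<in> G" unfolding G_def z by blast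
  next
    fix z assume zG: "z \<in> G"
    obtain x y where z: "z = (x, y)" by (cases z)
    have x: "x \<in> R\<inverse> `` space M" "y \<in> space M" using zG unfolding G_def z by blast+
    have k: "x \<in> R\<inverse> `` U k \<longleftrightarrow> y \<in> U k" for k using zG unfolding G_def z by blast
    obtain w where w: "(x, w) \<in> R" "w \<in> space M" using x by auto
    have "w = y"
    proof (rule ccontr)
      assume "w \<noteq> y"
      then obtain V where V: "openin T V" "y \<in> V" "w \<notin> V"
        using Hausdorff w x unfolding Hausdorff_space_def topspace_eq disjnt_def by blast
      then obtain k where "y \<in> U k" "U k \<subseteq> V" using U(2) by metis
      then have "x \<in> R\<inverse> `` U k" using k by blast
      then have "w \<in> U k" using single_valuedD[OF sv w(1)] by blast
      then show False using \<open>U k \<subseteq> V\<close> V by blast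
    qed
    then show "z \<in> R" using w z by simp
  qed
  ultimately show ?thesis by simp
qed

end

section \<open>Bimeasurable partial isomorphisms\<close>

text \<open>Inside the proof partial maps are replaced by their graphs, for which inverse,
  composition, powers and unions are operations on relations. \<open>rel_map\<close> leads back to
  partial maps.\<close>

definition rel_map :: "('a \<times> 'a) set \<Rightarrow> 'a \<rightharpoonup> 'a" where
  "rel_map R x = (if x \<in> Domain R then Some (THE y. (x, y) \<in> R) else None)"

lemma rel_map_eq:
  assumes "single_valued R" "(x, y) \<in> R"
  shows "rel_map R x = Some y"
  using assms unfolding rel_map_def by (auto intro!: the_equality dest: single_valuedD)

lemma rel_map_iff:
  assumes "single_valued R"
  shows "rel_map R x = Some y \<longleftrightarrow> (x, y) \<in> R"
proof
  assume *: "rel_map R x = Some y"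
  then obtain z where "(x, z) \<in> R" unfolding rel_map_def by (auto split: if_splits)
  with rel_map_eq[OF assms this] * show "(x, y) \<in> R" by simp
qed (use rel_map_eq[OF assms] in auto)

lemma graph_rel_map: "single_valued R \<Longrightarrow> Map.graph (rel_map R) = R"
  by (auto simp: Map.graph_def rel_map_iff)

lemma dom_rel_map: "dom (rel_map R) = Domain R"
  by (auto simp: dom_def rel_map_def)

lemma ran_rel_map: "single_valued R \<Longrightarrow> ran (rel_map R) = Range R"
  by (auto simp: ran_def rel_map_iff)

text \<open>
  Elements of \<open>[[E]]\<close> as relations. Measurability of images is part of the definition, because
  \<^const>\<open>full_pseudogroup\<close> only asks for measurability of preimages.
\<close>

definition pinj :: "'a measure \<Rightarrow> ('a \<times> 'a) set \<Rightarrow> ('a \<times> 'a) set set" where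
  "pinj M E = {R. R \<subseteq> E \<and> single_valued R \<and> single_valued (R\<inverse>) \<and>
     (\<forall>S\<in>sets M. R `` S \<in> sets M \<and> R\<inverse> `` S \<in> sets M)}"

lemma pinjD:
  assumes "R \<in> pinj M E"
  shows "R \<subseteq> E" "single_valued R" "single_valued (R\<inverse>)"
    "\<And>S. S \<in> sets M \<Longrightarrow> R `` S \<in> sets M" "\<And>S. S \<in> sets M \<Longrightarrow> R\<inverse> `` S \<in> sets M"
  using assms unfolding pinj_def by auto

lemma pinj_unique:
  assumes "R \<in> pinj M E"
  shows "(x, y) \<in> R \<Longrightarrow> (x, z) \<in> R \<Longrightarrow> y = z" "(x, z) \<in> R \<Longrightarrow> (y, z) \<in> R \<Longrightarrow> x = y"
  using pinjD[OF assms] by (auto dest: single_valuedD)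

locale mp_equiv = prob_space M for M :: "'a measure" +
  fixes E :: "('a \<times> 'a) set"
  assumes equiv: "equiv (space M) E"
    and mp: "measure_preserving_rel M E"
begin

lemma E_space: "E \<subseteq> space M \<times> space M"
  using equiv by (auto simp: equiv_def refl_on_def)

lemma pinj_Domain: "R \<in> pinj M E \<Longrightarrow> Domain R = R\<inverse> `` space M"
  using pinjD(1) E_space by fastforce

lemma pinj_Range: "R \<in> pinj M E \<Longrightarrow> Range R = R `` space M"
  using pinjD(1) E_space by fastforce

lemma pinj_sets [measurable, intro, simp]:
  assumes "R \<in> pinj M E"
  shows "Domain R \<in> sets M" "Range R \<in> sets M"
  using pinjD[OF assms] pinj_Domain[OF assms] pinj_Range[OF assms] by auto

lemma rel_map_pinj:
  assumes R: "R \<in> pinj M E"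
  shows "rel_map R \<in> full_pseudogroup M E"
proof -
  note D = pinjD[OF R]
  have sp: "Domain R \<subseteq> space M" "Range R \<subseteq> space M" using D(1) E_space by auto
  have "(\<lambda>x. the (rel_map R x)) \<in> measurable (restrict_space M (Domain R)) (restrict_space M (Range R))"
  proof (rule measurableI)
    fix x assume "x \<in> space (restrict_space M (Domain R))"
    then obtain y where "(x, y) \<in> R" by (auto simp: space_restrict_space)
    then show "the (rel_map R x) \<in> space (restrict_space M (Range R))"
      using sp rel_map_eq[OF D(2)] by (auto simp: space_restrict_space)
  next
    fix B assume "B \<in> sets (restrict_space M (Range R))"
    then obtain S where S: "S \<in> sets M" "B = Range R \<inter> S"
      by (auto simp: sets_restrict_space)
    have "(\<lambda>x. the (rel_map R x)) -` B \<inter> space (restrict_space M (Domain R)) = R\<inverse> `` S"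
      using sp rel_map_eq[OF D(2)] S(2) by (fastforce simp: space_restrict_space)
    moreover have "R\<inverse> `` S \<in> sets (restrict_space M (Domain R))"
      using D(5)[OF S(1)] R by (auto simp: sets_restrict_space_iff)
    ultimately show "(\<lambda>x. the (rel_map R x)) -` B \<inter> space (restrict_space M (Domain R))
        \<in> sets (restrict_space M (Domain R))" by simp
  qed
  moreover have "inj_on (rel_map R) (Domain R)"
  proof (rule inj_onI)
    fix x y assume *: "x \<in> Domain R" "y \<in> Domain R" "rel_map R x = rel_map R y"
    then obtain u v where "(x, u) \<in> R" "(y, v) \<in> R" by auto
    then show "x = y" using * rel_map_eq[OF D(2)] pinj_unique(2)[OF R] by simp
  qed
  ultimately show ?thesis
    unfolding full_pseudogroup_def
    using D R by (simp add: dom_rel_map ran_rel_map graph_rel_map)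
qed

text \<open>The one place where invariance of the measure is applied. By injectivity, the points
  sent into the image of \<open>S\<close> are those of \<open>S \<inter> Domain R\<close>.\<close>

lemma measure_pinj_Image:
  assumes R: "R \<in> pinj M E" and S: "S \<in> sets M"
  shows "measure M (R `` S) = measure M (S \<inter> Domain R)"
proof -
  note D = pinjD[OF R]
  have "emeasure M {x \<in> dom (rel_map R). the (rel_map R x) \<in> R `` S} = emeasure M (R `` S)"
  proof -
    have "R `` S \<in> sets M" "R `` S \<subseteq> ran (rel_map R)"
      using D(4)[OF S] by (auto simp: ran_rel_map[OF D(2)])
    then show ?thesis
      using mp[unfolded measure_preserving_rel_def] rel_map_pinj[OF R] by blast
  qed
  moreover have "{x \<in> dom (rel_map R). the (rel_map R x) \<in> R `` S} = S \<inter> Domain R"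
  proof -
    have "the (rel_map R x) \<in> R `` S \<longleftrightarrow> x \<in> S" if xy: "(x, y) \<in> R" for x y
    proof -
      have "y \<in> R `` S \<longleftrightarrow> x \<in> S" using pinj_unique(2)[OF R xy] xy by blast
      then show ?thesis using rel_map_eq[OF D(2) xy] by simp
    qed
    then show ?thesis by (auto simp: dom_rel_map)
  qed
  ultimately show ?thesis by (simp add: measure_def)
qed

section \<open>Closure properties of partial isomorphisms\<close>

lemma pinj_converse: "R \<in> pinj M E \<Longrightarrow> R\<inverse> \<in> pinj M E"
proof -
  assume R: "R \<in> pinj M E"
  have "sym E" using equiv by (simp add: equiv_def)
  then have "R\<inverse> \<subseteq> E" using pinjD(1)[OF R] by (auto dest: symD)
  then show ?thesis using pinjD(2-5)[OF R] by (simp add: pinj_def)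
qed

lemma pinj_relcomp:
  assumes "R \<in> pinj M E" "S \<in> pinj M E"
  shows "R O S \<in> pinj M E"
proof -
  note R = pinjD[OF assms(1)] and S = pinjD[OF assms(2)]
  have "trans E" using equiv by (simp add: equiv_def)
  then have "R O S \<subseteq> E" using R S by (auto dest: transD)
  then show ?thesis
    using R S unfolding pinj_def
    by (auto simp: converse_relcomp relcomp_Image intro: single_valued_relcomp)
qed

lemma pinj_Id_on:
  assumes "S \<in> sets M"
  shows "Id_on S \<in> pinj M E"
proof -
  have "refl_on (space M) E" using equiv by (simp add: equiv_def)
  then have "Id_on S \<subseteq> E" using sets.sets_into_space[OF assms] by (auto simp: refl_on_def)
  moreover have "Id_on S `` A = S \<inter> A" for A by auto
  ultimately show ?thesis using assms unfolding pinj_def by (auto simp: single_valued_def)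
qed

lemma pinj_restrict:
  assumes "R \<in> pinj M E" "A \<in> sets M" "B \<in> sets M"
  shows "R \<inter> (A \<times> B) \<in> pinj M E"
proof -
  have "R \<inter> (A \<times> B) = Id_on A O R O Id_on B" by auto
  then show ?thesis using assms by (simp add: pinj_relcomp pinj_Id_on)
qed

lemma pinj_UN:
  assumes "countable I" "\<And>i. i \<in> I \<Longrightarrow> R i \<in> pinj M E"
    and "single_valued (\<Union>i\<in>I. R i)" "single_valued ((\<Union>i\<in>I. R i)\<inverse>)"
  shows "(\<Union>i\<in>I. R i) \<in> pinj M E"
proof -
  have "(\<Union>i\<in>I. R i) `` S = (\<Union>i\<in>I. R i `` S)" "(\<Union>i\<in>I. R i)\<inverse> `` S = (\<Union>i\<in>I. (R i)\<inverse> `` S)" for S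
    by auto
  moreover have "(\<Union>i\<in>I. R i) \<subseteq> E" using pinjD(1)[OF assms(2)] by (rule UN_least)
  ultimately show ?thesis
    using assms(1,3,4) pinjD(4,5)[OF assms(2)] unfolding pinj_def
    by (auto intro!: sets.countable_UN')
qed

lemma pinj_Un:
  assumes "R \<in> pinj M E" "S \<in> pinj M E"
    and "Domain R \<inter> Domain S = {}" "Range R \<inter> Range S = {}"
  shows "R \<union> S \<in> pinj M E"
proof -
  have "single_valued (R \<union> S)"
    using assms(3) pinj_unique(1)[OF assms(1)] pinj_unique(1)[OF assms(2)]
    by (intro single_valuedI) blast
  moreover have "single_valued ((R \<union> S)\<inverse>)"
    using assms(4) pinj_unique(2)[OF assms(1)] pinj_unique(2)[OF assms(2)]
    by (intro single_valuedI) blast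
  ultimately have "single_valued (R \<union> S)" "single_valued ((R \<union> S)\<inverse>)" by auto
  then show ?thesis using pinj_UN[of "UNIV :: bool set" "\<lambda>b. if b then R else S"] assms
    by (simp add: UNIV_bool Un_commute)
qed

section \<open>Powers of a partial isomorphism\<close>

lemma pinj_relpow:
  assumes "R \<in> pinj M E"
  shows "Id_on (space M) O R ^^ j \<in> pinj M E"
proof (induction j)
  case 0
  then show ?case using pinj_Id_on[of "space M"] by simp
next
  case (Suc j)
  have "Id_on (space M) O R ^^ Suc j = (Id_on (space M) O R ^^ j) O R" by auto
  then show ?case using pinj_relcomp[OF Suc assms] by simp
qed

lemma relpow_unique:
  assumes "R \<in> pinj M E"
  shows "(x, y) \<in> R ^^ j \<Longrightarrow> (x, z) \<in> R ^^ j \<Longrightarrow> y = z"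
    "(x, z) \<in> R ^^ j \<Longrightarrow> (y, z) \<in> R ^^ j \<Longrightarrow> x = y"
proof -
  show "(x, y) \<in> R ^^ j \<Longrightarrow> (x, z) \<in> R ^^ j \<Longrightarrow> y = z"
    by (induction j arbitrary: y z) (auto dest: pinj_unique[OF assms])
  show "(x, z) \<in> R ^^ j \<Longrightarrow> (y, z) \<in> R ^^ j \<Longrightarrow> x = y"
    by (induction j arbitrary: z) (auto dest: pinj_unique[OF assms])
qed

text \<open>\<open>R ^^ 0\<close> is the identity on the whole type and need not be contained in
  \<open>E\<close>; powers are therefore cut down to \<open>space M\<close>, which changes nothing
  over a subset \<open>S\<close> of it.\<close>

lemma relpow_Image:
  assumes "R \<in> pinj M E" "S \<in> sets M"
  shows "(R ^^ j) `` S \<in> sets M"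
    and "measure M ((R ^^ j) `` S) = measure M (S \<inter> Domain (R ^^ j))"
proof -
  have 1: "(R ^^ j) `` S = (Id_on (space M) O R ^^ j) `` S"
    "S \<inter> Domain (R ^^ j) = S \<inter> Domain (Id_on (space M) O R ^^ j)"
    using sets.sets_into_space[OF assms(2)] by auto
  show "(R ^^ j) `` S \<in> sets M" "measure M ((R ^^ j) `` S) = measure M (S \<inter> Domain (R ^^ j))"
    unfolding 1 using pinj_relpow[OF assms(1)] assms(2) by (auto intro: pinjD measure_pinj_Image)
qed

lemma relpow_Domain:
  assumes "R \<in> pinj M E" "S \<in> sets M"
  shows "S \<inter> Domain (R ^^ j) \<in> sets M"
proof -
  have 1: "S \<inter> Domain (R ^^ j) = S \<inter> Domain (Id_on (space M) O R ^^ j)"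
    using sets.sets_into_space[OF assms(2)] by auto
  show ?thesis unfolding 1 using pinj_relpow[OF assms(1)] assms(2) by auto
qed

lemma relpow_Domain_mono:
  fixes R :: "('b \<times> 'b) set"
  assumes "j \<le> L" shows "Domain (R ^^ L) \<subseteq> Domain (R ^^ j)"
proof -
  have "R ^^ L = R ^^ j O R ^^ (L - j)" using assms by (metis le_add_diff_inverse relpow_add)
  then show ?thesis by auto
qed

text \<open>The images of \<open>Q\<close> under the powers \<open>0\<close> to \<open>L\<close> all
  have the measure of \<open>Q\<close>. They are disjoint: if two of them met, cancelling the
  smaller power would reach a point of \<open>Q\<close> by at least one step of \<open>R\<close>,
  but \<open>Q\<close> avoids the range.\<close>

lemma wandering:
  assumes R: "R \<in> pinj M E" and Q: "Q \<in> sets M" "Q \<inter> Range R = {}" "Q \<subseteq> Domain (R ^^ L)"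
  shows "real (L + 1) * measure M Q \<le> 1"
proof -
  have disj: "(R ^^ i) `` Q \<inter> (R ^^ j) `` Q = {}" if "i < j" for i j
  proof (rule ccontr)
    assume "(R ^^ i) `` Q \<inter> (R ^^ j) `` Q \<noteq> {}"
    then obtain z p q where *: "p \<in> Q" "q \<in> Q" "(p, z) \<in> R ^^ i" "(q, z) \<in> R ^^ j" by auto
    obtain d where d: "j = Suc d + i" using less_imp_Suc_add[OF \<open>i < j\<close>] by (auto simp: add.commute)
    with * have "(q, z) \<in> R ^^ Suc d O R ^^ i" by (simp only: relpow_add)
    then obtain w where "(q, w) \<in> R ^^ Suc d" "(w, z) \<in> R ^^ i" by auto
    then have "(q, p) \<in> R ^^ Suc d" using relpow_unique(2)[OF R] * by metis
    then show False using * Q by auto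
  qed
  then have "disjoint_family_on (\<lambda>j. (R ^^ j) `` Q) {..L}"
    unfolding disjoint_family_on_def by (metis inf_commute linorder_neqE_nat)
  then have "measure M (\<Union>j\<le>L. (R ^^ j) `` Q) = (\<Sum>j\<le>L. measure M ((R ^^ j) `` Q))"
    using relpow_Image[OF R Q(1)] by (intro finite_measure_finite_Union) auto
  also have "\<dots> = (\<Sum>j\<le>L. measure M Q)"
  proof (rule sum.cong)
    fix j assume "j \<in> {..L}"
    then have "Q \<inter> Domain (R ^^ j) = Q" using relpow_Domain_mono[of j L R] Q(3) by auto
    then show "measure M ((R ^^ j) `` Q) = measure M Q" using relpow_Image(2)[OF R Q(1)] by simp
  qed simp
  also have "\<dots> = real (L + 1) * measure M Q" by simp
  finally show ?thesis using prob_le_1 by metis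
qed

text \<open>Chains are determined by either endpoint and their length, so of two chains with a
  common end or a common start the shorter is part of the longer.\<close>

lemma relpow_cancel:
  assumes R: "R \<in> pinj M E" and "i \<le> j"
  shows "(p, z) \<in> R ^^ i \<Longrightarrow> (q, z) \<in> R ^^ j \<Longrightarrow> (q, p) \<in> R ^^ (j - i)"
    and "(z, p) \<in> R ^^ i \<Longrightarrow> (z, q) \<in> R ^^ j \<Longrightarrow> (p, q) \<in> R ^^ (j - i)"
proof -
  have 1: "R ^^ j = R ^^ (j - i) O R ^^ i" "R ^^ j = R ^^ i O R ^^ (j - i)"
    using \<open>i \<le> j\<close> by (simp_all flip: relpow_add)
  show "(p, z) \<in> R ^^ i \<Longrightarrow> (q, z) \<in> R ^^ j \<Longrightarrow> (q, p) \<in> R ^^ (j - i)"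
    using relpow_unique(2)[OF R] by (subst (asm) 1(1)) blast
  show "(z, p) \<in> R ^^ i \<Longrightarrow> (z, q) \<in> R ^^ j \<Longrightarrow> (p, q) \<in> R ^^ (j - i)"
    using relpow_unique(1)[OF R] by (subst (asm) 1(2)) blast
qed

lemma relpow_space:
  assumes R: "R \<in> pinj M E"
  shows "(x, y) \<in> R ^^ j \<Longrightarrow> x \<in> space M \<longleftrightarrow> y \<in> space M"
proof (induction j arbitrary: y)
  case (Suc j)
  then show ?case using pinjD(1)[OF R] E_space by fastforce
qed auto

lemma relpow_converse:
  fixes R :: "('b \<times> 'b) set"
  shows "(R\<inverse>) ^^ j = (R ^^ j)\<inverse>"
proof (induction j)
  case (Suc j)
  have "(R\<inverse>) ^^ Suc j = (R ^^ j)\<inverse> O R\<inverse>" using Suc by simp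
  also have "\<dots> = (R O R ^^ j)\<inverse>" by (simp only: converse_relcomp)
  also have "\<dots> = (R ^^ Suc j)\<inverse>" by (simp only: relpow_commute relpow.simps)
  finally show ?case .
qed auto

section \<open>Extension to the full group\<close>

text \<open>
  The one-sided infinite \<open>R\<close>-chains. They have no end that could be sent back to their start.
\<close>

definition escaping :: "('a \<times> 'a) set \<Rightarrow> 'a set" where
  "escaping R = (\<Union>j. (R ^^ j) `` (\<Inter>i. (space M - Range R) \<inter> Domain (R ^^ i)))"

text \<open>The starting points of infinite chains satisfy \<open>wandering\<close> for every
  \<open>L\<close>, hence form a null set; so do their images.\<close>

lemma escaping_null:
  assumes R: "R \<in> pinj M E"
  shows "escaping R \<in> null_sets M"
proof -
  let ?B = "\<Inter>i. (space M - Range R) \<inter> Domain (R ^^ i)"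
  have "(space M - Range R) \<inter> Domain (R ^^ i) \<in> sets M" for i
    using R by (intro relpow_Domain[OF R]) auto
  then have BM: "?B \<in> sets M" by (intro sets.countable_INT) (simp only: image_subset_iff, simp, simp)
  have "measure M ?B \<le> 1 / Suc L" for L
  proof -
    have "?B \<inter> Range R = {}" "?B \<subseteq> Domain (R ^^ L)" by auto
    from wandering[OF R BM this] show ?thesis by (simp add: field_simps)
  qed
  then have "measure M ?B \<le> 0" by (metis linorder_not_less nat_approx_posE)
  then have B0: "measure M ?B = 0" by (simp add: measure_le_0_iff)
  have "(R ^^ j) `` ?B \<in> null_sets M" for j
  proof -
    have "measure M ((R ^^ j) `` ?B) \<le> measure M ?B"
      unfolding relpow_Image(2)[OF R BM] using BM by (intro finite_measure_mono) auto
    then have "measure M ((R ^^ j) `` ?B) = 0" using B0 by (simp add: measure_le_0_iff)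
    then show ?thesis using relpow_Image(1)[OF R BM] by (auto simp: emeasure_eq_measure)
  qed
  then show ?thesis unfolding escaping_def by (intro null_sets_UN') auto
qed

text \<open>A point with a predecessor is not a starting point, so the chain that reaches
  \<open>y\<close> has positive length and its last step comes from \<open>x\<close>.\<close>

lemma escaping_invariant:
  assumes R: "R \<in> pinj M E" and xy: "(x, y) \<in> R"
  shows "x \<in> escaping R \<longleftrightarrow> y \<in> escaping R"
proof
  assume "x \<in> escaping R"
  then obtain b j where b: "b \<in> (\<Inter>i. (space M - Range R) \<inter> Domain (R ^^ i))" "(b, x) \<in> R ^^ j"
    unfolding escaping_def by blast
  then have "(b, y) \<in> R ^^ Suc j" using xy by auto
  then show "y \<in> escaping R" using b(1) unfolding escaping_def by blast
next
  assume "y \<in> escaping R"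
  then obtain b j where b: "b \<in> (\<Inter>i. (space M - Range R) \<inter> Domain (R ^^ i))" "(b, y) \<in> R ^^ j"
    unfolding escaping_def by blast
  have "j \<noteq> 0" using b xy by (cases j) auto
  then obtain i where "j = Suc i" by (cases j) auto
  then have "(b, x) \<in> R ^^ i" using b(2) pinj_unique(2)[OF R xy] by auto
  then show "x \<in> escaping R" using b(1) unfolding escaping_def by blast
qed

text \<open>Some power of \<open>R\<close> is undefined at \<open>y\<close>, since otherwise
  \<open>y\<close> would start an infinite chain. The chain from \<open>y\<close> ends one step
  before the first such power.\<close>

lemma nonescaping_end:
  assumes R: "R \<in> pinj M E" and y: "y \<in> space M - Range R" "y \<notin> escaping R"
  shows "\<exists>j z. (y, z) \<in> R ^^ j \<and> z \<in> space M - Domain R"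
proof -
  have "y \<in> (R ^^ 0) `` {y}" by simp
  then have "\<exists>i. y \<notin> Domain (R ^^ i)" using y unfolding escaping_def by blast
  then obtain i where i: "y \<notin> Domain (R ^^ i)" "\<And>j. j < i \<Longrightarrow> y \<in> Domain (R ^^ j)"
    using exists_least_iff[of "\<lambda>i. y \<notin> Domain (R ^^ i)"] by blast
  then obtain j where j: "i = Suc j" by (cases i) auto
  then obtain z where z: "(y, z) \<in> R ^^ j" using i(2)[of j] by auto
  then have "z \<notin> Domain R" using i(1) j by auto
  then show ?thesis using z relpow_space[OF R z] y by blast
qed

text \<open>A chain with a start and an end is closed to a cycle; cycles and two-sided infinite
  chains are bijective already. One-sided infinite chains fill a null set \<open>N\<close>, on which
  the identity is used instead.\<close>

lemma extend_to_full:
  assumes R: "R \<in> pinj M E"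
  shows "\<exists>\<theta> N. \<theta> \<in> pinj M E \<and> Domain \<theta> = space M \<and> Range \<theta> = space M \<and>
    N \<in> null_sets M \<and> (\<forall>x y. (x, y) \<in> R \<and> x \<notin> N \<longrightarrow> (x, y) \<in> \<theta>)"
proof -
  define A where "A = space M - Domain R"
  define B where "B = space M - Range R"
  have AB: "A \<in> sets M" "B \<in> sets M" using R by (auto simp: A_def B_def)
  define N where "N = escaping R \<union> escaping (R\<inverse>)"
  have N: "N \<in> null_sets M"
    unfolding N_def using escaping_null R pinj_converse by blast
  have inv: "x \<in> N \<longleftrightarrow> y \<in> N" if "(x, y) \<in> R" for x y
    using escaping_invariant[OF R that] escaping_invariant[OF pinj_converse[OF R], of y x] that
    unfolding N_def by blast
  have inv': "x \<in> N \<longleftrightarrow> y \<in> N" if "(x, y) \<in> R ^^ j" for x y j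
    using that by (induction j arbitrary: y) (auto dest: inv)
  \<comment> \<open>\<open>C\<close> sends the end of a finite chain to its start. The case
    \<open>j = 0\<close> fixes the points that lie in neither \<open>Domain R\<close> nor
    \<open>Range R\<close>.\<close>
  define C where "C = (\<Union>j. ((Id_on (space M) O R ^^ j) \<inter> (B \<times> A))\<inverse>)"
  have C_iff: "(z, y) \<in> C \<longleftrightarrow> z \<in> A \<and> y \<in> B \<and> (\<exists>j. (y, z) \<in> R ^^ j)" for z y
    unfolding C_def by (auto simp: B_def)
  have Range_pow: "p \<in> Range R" if "(q, p) \<in> R ^^ d" "d > 0" for p q d
    using that by (cases d) auto
  have Domain_pow: "q \<in> Domain R" if "(q, p) \<in> R ^^ d" "d > 0" for p q d
    using that by (cases d) (auto dest!: relpow_Suc_D2 simp del: relpow.simps(2))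
  have C: "C \<in> pinj M E"
    unfolding C_def
  proof (rule pinj_UN; (fold C_def)?)
    show "((Id_on (space M) O R ^^ j) \<inter> (B \<times> A))\<inverse> \<in> pinj M E" for j
      using AB pinj_relpow[OF R] by (intro pinj_converse pinj_restrict)
    \<comment> \<open>A start has no predecessor, so two starts reach a common end after equally
      many steps and coincide. Dually for ends below.\<close>
    have same: "i = j" if "y \<in> B" "y' \<in> B" "(y, z) \<in> R ^^ i" "(y', z) \<in> R ^^ j" for y y' z i j
    proof (rule ccontr)
      assume "i \<noteq> j"
      then consider "i < j" | "j < i" by linarith
      then show False
      proof cases
        case 1
        then have "y \<in> Range R" using relpow_cancel(1)[OF R _ that(3,4)] Range_pow[of y' y "j - i"] by simp
        then show False using that(1) by (simp add: B_def)
      next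
        case 2
        then have "y' \<in> Range R" using relpow_cancel(1)[OF R _ that(4,3)] Range_pow[of y y' "i - j"] by simp
        then show False using that(2) by (simp add: B_def)
      qed
    qed
    have same': "i = j" if "z \<in> A" "z' \<in> A" "(y, z) \<in> R ^^ i" "(y, z') \<in> R ^^ j" for y z z' i j
    proof (rule ccontr)
      assume "i \<noteq> j"
      then consider "i < j" | "j < i" by linarith
      then show False
      proof cases
        case 1
        then have "z \<in> Domain R" using relpow_cancel(2)[OF R _ that(3,4)] Domain_pow[of z z' "j - i"] by simp
        then show False using that(1) by (simp add: A_def)
      next
        case 2
        then have "z' \<in> Domain R" using relpow_cancel(2)[OF R _ that(4,3)] Domain_pow[of z' z "i - j"] by simp
        then show False using that(2) by (simp add: A_def)
      qed
    qed
    show "single_valued C"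
      by (rule single_valuedI) (metis C_iff same relpow_unique(2)[OF R])
    show "single_valued (C\<inverse>)"
      by (rule single_valuedI) (metis C_iff converse_iff same' relpow_unique(1)[OF R])
  qed auto
  define S where "S = R \<union> C"
  have S: "S \<in> pinj M E"
    unfolding S_def by (rule pinj_Un[OF R C]) (auto simp: C_iff A_def B_def)
  have invS: "x \<in> N \<longleftrightarrow> y \<in> N" if "(x, y) \<in> S" for x y
    using that inv inv' unfolding S_def by (auto simp: C_iff)
  have dom: "x \<in> Domain S" if "x \<in> space M" "x \<notin> N" for x
  proof (cases "x \<in> Domain R")
    case False
    then have "x \<in> space M - Range (R\<inverse>)" "x \<notin> escaping (R\<inverse>)" using that by (auto simp: N_def)
    then obtain j y where "(x, y) \<in> (R\<inverse>) ^^ j" "y \<in> space M - Domain (R\<inverse>)"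
      using nonescaping_end[OF pinj_converse[OF R]] by blast
    then have "(x, y) \<in> C" using that False by (auto simp: C_iff A_def B_def relpow_converse)
    then show ?thesis by (auto simp: S_def)
  qed (auto simp: S_def)
  have ran: "y \<in> Range S" if "y \<in> space M" "y \<notin> N" for y
  proof (cases "y \<in> Range R")
    case False
    then have "y \<in> space M - Range R" "y \<notin> escaping R" using that by (auto simp: N_def)
    then obtain j z where "(y, z) \<in> R ^^ j" "z \<in> space M - Domain R"
      using nonescaping_end[OF R] by blast
    then have "(z, y) \<in> C" using that False by (auto simp: C_iff A_def B_def)
    then show ?thesis by (auto simp: S_def)
  qed (auto simp: S_def)
  \<comment> \<open>\<open>N\<close> is a union of whole chains, so removing it from
    \<open>S\<close> leaves a bijection of the complement.\<close>
  define \<theta> where "\<theta> = S \<inter> ((space M - N) \<times> (space M - N)) \<union> Id_on N"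
  have NM: "N \<in> sets M" using N by auto
  have Ssp: "S \<subseteq> space M \<times> space M" using pinjD(1)[OF S] E_space by blast
  have "\<theta> \<in> pinj M E"
    unfolding \<theta>_def using S NM by (intro pinj_Un pinj_restrict pinj_Id_on) auto
  moreover have "Domain \<theta> = space M"
  proof
    show "Domain \<theta> \<subseteq> space M" unfolding \<theta>_def using sets.sets_into_space[OF NM] by auto
    show "space M \<subseteq> Domain \<theta>"
    proof
      fix x assume x: "x \<in> space M"
      show "x \<in> Domain \<theta>"
      proof (cases "x \<in> N")
        case False
        then obtain y where "(x, y) \<in> S" using dom[OF x] by blast
        then have "(x, y) \<in> \<theta>" using False invS Ssp unfolding \<theta>_def by blast
        then show ?thesis by blast
      qed (auto simp: \<theta>_def)
    qed
  qed
  moreover have "Range \<theta> = space M"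
  proof
    show "Range \<theta> \<subseteq> space M" unfolding \<theta>_def using sets.sets_into_space[OF NM] by auto
    show "space M \<subseteq> Range \<theta>"
    proof
      fix y assume y: "y \<in> space M"
      show "y \<in> Range \<theta>"
      proof (cases "y \<in> N")
        case False
        then obtain x where "(x, y) \<in> S" using ran[OF y] by blast
        then have "(x, y) \<in> \<theta>" using False invS Ssp unfolding \<theta>_def by blast
        then show ?thesis by blast
      qed (auto simp: \<theta>_def)
    qed
  qed
  moreover have "(x, y) \<in> \<theta>" if "(x, y) \<in> R" "x \<notin> N" for x y
  proof -
    have "(x, y) \<in> S" using that by (simp add: S_def)
    then show ?thesis using that inv Ssp unfolding \<theta>_def by blast
  qed
  ultimately show ?thesis using N by blast
qed

end

section \<open>Edge colourings\<close>

text \<open>\<open>R i\<close> holds the edges of the \<open>i\<close>-th member, with left and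
  right vertices both taken from \<open>X\<close>. The degree bounds are pointwise, so that every
  uncoloured edge has free colours at both ends.\<close>

locale edge_colouring = mp_equiv M E for M :: "'a measure" and E +
  fixes R :: "nat \<Rightarrow> ('a \<times> 'a) set" and k n :: nat
  assumes R: "i < k \<Longrightarrow> R i \<in> pinj M E"
    and deg_left: "card {i. i < k \<and> x \<in> Domain (R i)} \<le> n"
    and deg_right: "card {i. i < k \<and> y \<in> Range (R i)} \<le> n"
begin

section \<open>Proper partial colourings\<close>

definition colour_class :: "(nat \<Rightarrow> 'a \<Rightarrow> nat) \<Rightarrow> nat \<Rightarrow> ('a \<times> 'a) set" where
  "colour_class c a = (\<Union>i<k. {(x, y). (x, y) \<in> R i \<and> c i x = a})"

text \<open>
  The edge \<open>(x, y)\<close> of \<open>R i\<close> has colour \<open>c i x\<close>; values \<open>\<ge> n\<close> mean that it is uncoloured.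
\<close>

definition uncoloured :: "(nat \<Rightarrow> 'a \<Rightarrow> nat) \<Rightarrow> nat \<Rightarrow> 'a set" where
  "uncoloured c i = {x \<in> Domain (R i). \<not> c i x < n}"

text \<open>Equality of indices suffices in the last two conditions, because edges of the same
  \<open>R i\<close> with a common vertex coincide. Only genuine colours, those below
  \<open>n\<close>, are constrained.\<close>

definition proper :: "(nat \<Rightarrow> 'a \<Rightarrow> nat) \<Rightarrow> bool" where
  "proper c \<longleftrightarrow>
    (\<forall>i<k. \<forall>a<n. {x \<in> Domain (R i). c i x = a} \<in> sets M) \<and>
    (\<forall>i<k. \<forall>j<k. \<forall>x. x \<in> Domain (R i) \<and> x \<in> Domain (R j) \<and> c i x = c j x \<and> c i x < n \<longrightarrow> i = j) \<and>
    (\<forall>i<k. \<forall>j<k. \<forall>x x' y. (x, y) \<in> R i \<and> (x', y) \<in> R j \<and> c i x = c j x' \<and> c i x < n \<longrightarrow> i = j)"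

lemma properD:
  assumes "proper c"
  shows "i < k \<Longrightarrow> a < n \<Longrightarrow> {x \<in> Domain (R i). c i x = a} \<in> sets M"
    "i < k \<Longrightarrow> j < k \<Longrightarrow> x \<in> Domain (R i) \<Longrightarrow> x \<in> Domain (R j) \<Longrightarrow> c i x = c j x \<Longrightarrow> c i x < n \<Longrightarrow> i = j"
    "i < k \<Longrightarrow> j < k \<Longrightarrow> (x, y) \<in> R i \<Longrightarrow> (x', y) \<in> R j \<Longrightarrow> c i x = c j x' \<Longrightarrow> c i x < n \<Longrightarrow> i = j"
  using assms unfolding proper_def by blast+

lemma colour_class_iff: "(x, y) \<in> colour_class c a \<longleftrightarrow> (\<exists>i<k. (x, y) \<in> R i \<and> c i x = a)"
  by (auto simp: colour_class_def)

text \<open>Properness makes a colour class a matching, hence the graph of a partial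
  isomorphism.\<close>

lemma colour_class_pinj:
  assumes c: "proper c" and a: "a < n"
  shows "colour_class c a \<in> pinj M E"
  unfolding colour_class_def
proof (rule pinj_UN)
  fix i assume i: "i \<in> {..<k}"
  then have "R i \<inter> ({x \<in> Domain (R i). c i x = a} \<times> space M) \<in> pinj M E"
    using R properD(1)[OF c] a by (intro pinj_restrict) auto
  moreover have "R i \<inter> ({x \<in> Domain (R i). c i x = a} \<times> space M) = {(x, y). (x, y) \<in> R i \<and> c i x = a}"
    using pinjD(1)[OF R] i E_space by auto
  ultimately show "{(x, y). (x, y) \<in> R i \<and> c i x = a} \<in> pinj M E" by simp
next
  show "single_valued (\<Union>i<k. {(x, y). (x, y) \<in> R i \<and> c i x = a})"
  proof (rule single_valuedI, clarsimp)
    fix x y y' i j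
    assume *: "i < k" "(x, y) \<in> R i" "a = c i x" "j < k" "(x, y') \<in> R j" "c j x = c i x"
    then have "i = j" using properD(2)[OF c, of i j x] a by auto
    then show "y = y'" using * pinj_unique(1)[OF R] by metis
  qed
  show "single_valued ((\<Union>i<k. {(x, y). (x, y) \<in> R i \<and> c i x = a})\<inverse>)"
  proof (rule single_valuedI, clarsimp)
    fix x x' y i j
    assume *: "i < k" "(x, y) \<in> R i" "a = c i x" "j < k" "(x', y) \<in> R j" "c j x' = c i x"
    then have "i = j" using properD(3)[OF c, of i j x y x'] a by auto
    then show "x = x'" using * pinj_unique(2)[OF R] by metis
  qed
qed auto

lemma uncoloured_sets:
  assumes c: "proper c" and i: "i < k"
  shows "uncoloured c i \<in> sets M"
proof -
  have "uncoloured c i = Domain (R i) - (\<Union>a<n. {x \<in> Domain (R i). c i x = a})"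
    unfolding uncoloured_def by auto
  then show ?thesis using properD(1)[OF c] R[OF i] i by auto
qed

text \<open>Pigeonhole: the index \<open>i\<close> uses no colour below \<open>n\<close>, so at most
  \<open>n - 1\<close> indices compete for \<open>n\<close> colours.\<close>

lemma missing_colour:
  assumes "finite J" "card J \<le> n" "i \<in> J" "\<not> f i < n"
  shows "\<exists>a<n. a \<notin> f ` (J :: nat set)"
proof (rule ccontr)
  assume "\<not> ?thesis"
  then have "{..<n} \<subseteq> f ` (J - {i})" using assms(4) by fastforce
  then have "n \<le> card (f ` (J - {i}))" using assms(1) card_mono[of "f ` (J - {i})" "{..<n}"] by simp
  also have "\<dots> \<le> card (J - {i})" using assms(1) by (intro card_image_le) simp
  also have "\<dots> < n" using assms by (metis card_Diff1_less order_less_le_trans)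
  finally show False by simp
qed

lemma missing_left:
  assumes "i < k" "x \<in> uncoloured c i"
  shows "\<exists>a<n. x \<notin> Domain (colour_class c a)"
proof -
  have "\<exists>a<n. a \<notin> (\<lambda>i. c i x) ` {i. i < k \<and> x \<in> Domain (R i)}"
    using assms deg_left by (intro missing_colour[of _ i]) (auto simp: uncoloured_def)
  then show ?thesis by (fastforce simp: colour_class_iff)
qed

lemma missing_right:
  assumes c: "proper c" and i: "i < k" "x \<in> uncoloured c i" "(x, y) \<in> R i"
  shows "\<exists>b<n. y \<notin> Range (colour_class c b)"
proof -
  \<comment> \<open>Colours are attached to left endpoints; \<open>p j\<close> recovers the left
    endpoint of the edge of \<open>R j\<close> that ends in \<open>y\<close>.\<close>
  define p where "p j = (THE x. (x, y) \<in> R j)" for j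
  have p: "p j = x" if "(x, y) \<in> R j" "j < k" for x j
    unfolding p_def using that pinj_unique(2)[OF R] by blast
  have "\<exists>b<n. b \<notin> (\<lambda>j. c j (p j)) ` {j. j < k \<and> y \<in> Range (R j)}"
    using i deg_right p[OF i(3,1)] by (intro missing_colour[of _ i]) (auto simp: uncoloured_def)
  then obtain b where "b < n" "b \<notin> (\<lambda>j. c j (p j)) ` {j. j < k \<and> y \<in> Range (R j)}" by blast
  then have "y \<notin> Range (colour_class c b)" using p by (fastforce simp: colour_class_iff)
  then show ?thesis using \<open>b < n\<close> by blast
qed

section \<open>Alternating paths and augmentation\<close>

text \<open>
  Two consecutive edges of an alternating path, as a map between right vertices.
\<close>

definition kempe :: "(nat \<Rightarrow> 'a \<Rightarrow> nat) \<Rightarrow> nat \<Rightarrow> nat \<Rightarrow> ('a \<times> 'a) set" where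
  "kempe c a b = (colour_class c a)\<inverse> O colour_class c b"

text \<open>The right endpoints of uncoloured edges of \<open>R i\<close> with \<open>a\<close> free
  on the left, \<open>b\<close> free on the right, and an alternating path of fewer than
  \<open>L\<close> double steps.\<close>

definition augmentable :: "(nat \<Rightarrow> 'a \<Rightarrow> nat) \<Rightarrow> nat \<Rightarrow> nat \<Rightarrow> nat \<Rightarrow> nat \<Rightarrow> 'a set" where
  "augmentable c L i a b = R i `` (uncoloured c i - Domain (colour_class c a))
     - Range (colour_class c b) - Domain (kempe c a b ^^ L)"

lemma kempe_pinj: "proper c \<Longrightarrow> a < n \<Longrightarrow> b < n \<Longrightarrow> kempe c a b \<in> pinj M E"
  unfolding kempe_def by (intro pinj_relcomp pinj_converse colour_class_pinj)

lemma augmentable_sets: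
  assumes "proper c" "a < n" "b < n" "i < k"
  shows "augmentable c L i a b \<in> sets M"
proof -
  have "R i `` (uncoloured c i - Domain (colour_class c a)) \<in> sets M" (is "?A \<in> _")
    using assms R uncoloured_sets colour_class_pinj by (intro pinjD(4)) auto
  moreover have "augmentable c L i a b = ?A - Range (colour_class c b) - (?A \<inter> Domain (kempe c a b ^^ L))"
    unfolding augmentable_def by blast
  ultimately show ?thesis
    using relpow_Domain[OF kempe_pinj] assms colour_class_pinj by auto
qed

text \<open>\<open>Y\<close> and \<open>F\<close> are the right and left vertices on the alternating
  paths from \<open>P\<close>. An edge of colour \<open>a\<close> or \<open>b\<close> has both or
  none of its endpoints there, so exchanging the colours over \<open>F\<close> keeps the colouring
  proper. Afterwards \<open>a\<close> is free at both ends of each edge from \<open>X\<close> to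
  \<open>P\<close>.\<close>

lemma augment:
  assumes c: "proper c" and a: "a < n" and b: "b < n" and i0: "i0 < k" and L: "L > 0"
  defines "P \<equiv> augmentable c L i0 a b"
  shows "\<exists>c'. proper c' \<and> (\<forall>i<k. uncoloured c' i = uncoloured c i - (if i = i0 then (R i0)\<inverse> `` P else {}))"
proof -
  define \<alpha> where "\<alpha> = colour_class c a"
  define \<beta> where "\<beta> = colour_class c b"
  define g where "g = kempe c a b"
  have \<alpha>: "\<alpha> \<in> pinj M E" and \<beta>: "\<beta> \<in> pinj M E" and g: "g \<in> pinj M E"
    using c a b by (simp_all add: \<alpha>_def \<beta>_def g_def colour_class_pinj kempe_pinj)
  have g_eq: "g = \<alpha>\<inverse> O \<beta>" by (simp add: g_def \<alpha>_def \<beta>_def kempe_def)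
  have PM: "P \<in> sets M" unfolding P_def using assms by (intro augmentable_sets)
  define X where "X = (R i0)\<inverse> `` P"
  define Y where "Y = (\<Union>j<L. (g ^^ j) `` P)"
  define F where "F = \<alpha>\<inverse> `` Y"
  define sw where "sw v = (if v = a then b else if v = b then a else v)" for v
  \<comment> \<open>An edge is addressed by its left endpoint, so membership in \<open>F\<close>
    decides about the swap. \<open>sw\<close> fixes all values other than \<open>a\<close> and
    \<open>b\<close>, in particular those of uncoloured edges.\<close>
  define c' where "c' i x = (if i = i0 \<and> x \<in> X then a else if x \<in> F then sw (c i x) else c i x)" for i x
  have P: "y \<notin> Range \<beta>" "y \<notin> Domain (g ^^ L)" if "y \<in> P" for y
    using that by (auto simp: P_def augmentable_def \<beta>_def g_def)
  have XM: "X \<in> sets M" unfolding X_def using PM pinjD(5)[OF R[OF i0]] by auto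
  have YM: "Y \<in> sets M" unfolding Y_def using relpow_Image(1)[OF g PM] by auto
  have FM: "F \<in> sets M" unfolding F_def using pinjD(5)[OF \<alpha> YM] .
  \<comment> \<open>The paths include their starting points, as step \<open>0\<close> is allowed by
    \<open>L > 0\<close>.\<close>
  have PY: "P \<subseteq> Y"
  proof
    fix y assume "y \<in> P"
    then have "y \<in> (g ^^ 0) `` P" by simp
    then show "y \<in> Y" using L unfolding Y_def by blast
  qed
  have X: "x \<in> uncoloured c i0" "x \<notin> Domain \<alpha>" if "x \<in> X" for x
    using that pinj_unique(2)[OF R[OF i0]] unfolding X_def P_def augmentable_def \<alpha>_def[symmetric]
    by blast+
  \<comment> \<open>A path enters left vertices only along edges of colour \<open>a\<close>, and
    vertices of \<open>X\<close> have none: the path never reaches the other end of an uncoloured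
    edge.\<close>
  have XF: "x \<notin> F" if "x \<in> X" for x using X(2)[OF that] unfolding F_def by blast
  have F_alpha: "x \<in> F \<longleftrightarrow> y \<in> Y" if "(x, y) \<in> \<alpha>" for x y
    using that pinj_unique(1)[OF \<alpha>] unfolding F_def by blast
  \<comment> \<open>Both ends of the paths matter here. Going forward, step \<open>L\<close> is
    never reached, so the path stays in \<open>Y\<close>; going backward, a point of
    \<open>P\<close> has no edge of colour \<open>b\<close>, so \<open>y\<close> is not a starting
    point.\<close>
  have F_beta: "x \<in> F \<longleftrightarrow> y \<in> Y" if xy: "(x, y) \<in> \<beta>" for x y
  proof
    assume "x \<in> F"
    then obtain y0 j p where *: "(x, y0) \<in> \<alpha>" "j < L" "p \<in> P" "(p, y0) \<in> g ^^ j"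
      unfolding F_def Y_def by blast
    then have py: "(p, y) \<in> g ^^ Suc j" using xy by (auto simp: g_eq)
    then have "Suc j \<noteq> L" using P(2)[OF *(3)] by blast
    then show "y \<in> Y" using py * unfolding Y_def by (intro UN_I[of "Suc j"]) auto
  next
    assume "y \<in> Y"
    then obtain p j where *: "j < L" "p \<in> P" "(p, y) \<in> g ^^ j" unfolding Y_def by blast
    have "j \<noteq> 0" using P(1)[OF *(2)] * xy by (cases j) auto
    then obtain j' where j': "j = Suc j'" by (cases j) auto
    then obtain y0 where y0: "(p, y0) \<in> g ^^ j'" "(y0, y) \<in> g" using * by auto
    then obtain x' where x': "(x', y0) \<in> \<alpha>" "(x', y) \<in> \<beta>" by (auto simp: g_eq)
    then have "x' = x" using pinj_unique(2)[OF \<beta>] xy by metis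
    moreover have "y0 \<in> Y" using y0 * j' unfolding Y_def by (intro UN_I[of j']) auto
    ultimately show "x \<in> F" using x' unfolding F_def by blast
  qed
  have sw_less: "sw v < n \<longleftrightarrow> v < n" for v using a b by (simp add: sw_def)
  have sw_sw: "sw (sw v) = v" for v by (simp add: sw_def)
  have sw_inj: "sw u = sw v \<longleftrightarrow> u = v" for u v by (metis sw_sw)
  have ab: "(x, y) \<in> \<alpha> \<or> (x, y) \<in> \<beta>" if "i < k" "(x, y) \<in> R i" "c i x = a \<or> c i x = b" for i x y
    using that by (auto simp: \<alpha>_def \<beta>_def colour_class_iff)
  have FY: "x \<in> F \<longleftrightarrow> y \<in> Y" if "i < k" "(x, y) \<in> R i" "c i x = a \<or> c i x = b" for i x y
    using ab[OF that] F_alpha F_beta by blast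
  have old: "c' i x = (if x \<in> F then sw (c i x) else c i x)" if "\<not> (i = i0 \<and> x \<in> X)" for i x
    using that unfolding c'_def by (rule if_not_P)
  have new: "c' i0 x = a" if "x \<in> X" for x using that by (simp add: c'_def)
  have "proper c'"
    unfolding proper_def
  proof (intro conjI allI impI)
    fix i v assume i: "i < k" and v: "v < n"
    let ?D = "\<lambda>v. {x \<in> Domain (R i). c i x = v}"
    let ?X = "if i = i0 then X else {}"
    have eq: "{x \<in> Domain (R i). c' i x = v} =
        (if v = a then ?X else {}) \<union> (((?D v - F) \<union> (?D (sw v) \<inter> F)) - ?X)"
    proof -
      have "X \<subseteq> Domain (R i0)" unfolding X_def by auto
      moreover have "sw u = v \<longleftrightarrow> u = sw v" for u using sw_sw by metis
      ultimately show ?thesis by (auto simp: c'_def)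
    qed
    have "?D v \<in> sets M" "?D (sw v) \<in> sets M"
      using properD(1)[OF c i] v sw_less by auto
    moreover have "?X \<in> sets M" "(if v = a then ?X else {}) \<in> sets M" using XM by auto
    ultimately show "{x \<in> Domain (R i). c' i x = v} \<in> sets M"
      unfolding eq using FM by (intro sets.Un sets.Diff sets.Int)
  next
    fix i j x
    assume i: "i < k" and j: "j < k"
      and *: "x \<in> Domain (R i) \<and> x \<in> Domain (R j) \<and> c' i x = c' j x \<and> c' i x < n"
    \<comment> \<open>Colours at a vertex of \<open>X\<close> are not swapped, and \<open>a\<close>
      was free there, so no other edge has colour \<open>a\<close> now.\<close>
    have mixed: False if "x \<in> X" "l < k" "x \<in> Domain (R l)" "l \<noteq> i0" "c' l x = a" for l
    proof -
      have "c l x = a" using that old[of l x] XF[OF that(1)] by simp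
      then have "x \<in> Domain \<alpha>" using that unfolding \<alpha>_def by (auto simp: Domain_iff colour_class_iff)
      then show False using X(2)[OF that(1)] by simp
    qed
    show "i = j"
    proof (cases "x \<in> X \<and> (i = i0 \<or> j = i0)")
      case True
      then show ?thesis using mixed[of i] mixed[of j] new * i j by metis
    next
      case False
      then have "c i x = c j x" "c i x < n"
        using * old[of i x] old[of j x] sw_inj sw_less by (auto split: if_splits)
      then show ?thesis using properD(2)[OF c i j] * by blast
    qed
  next
    fix i j x x' y
    assume i: "i < k" and j: "j < k"
      and *: "(x, y) \<in> R i \<and> (x', y) \<in> R j \<and> c' i x = c' j x' \<and> c' i x < n"
    \<comment> \<open>At \<open>y \<in> P\<close> all edges of colour \<open>a\<close> or
      \<open>b\<close> are swapped. Another edge with new colour \<open>a\<close> would have had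
      colour \<open>b\<close>, which is missing at \<open>y\<close>.\<close>
    have mixed: False if "z \<in> X" "(z, y) \<in> R i0" "l < k" "(w, y) \<in> R l" "\<not> (l = i0 \<and> w \<in> X)" "c' l w = a" for l z w
    proof -
      have yP: "y \<in> P" using that(1,2) pinj_unique(1)[OF R[OF i0]] unfolding X_def by blast
      have cw: "c l w = a \<or> c l w = b"
        using that(6) old[OF that(5)] unfolding sw_def by (auto split: if_splits)
      then have "w \<in> F" using FY[OF that(3,4)] yP PY by blast
      then have "sw (c l w) = a" using old[OF that(5)] that(6) by simp
      then have "c l w = b" using cw unfolding sw_def by (auto split: if_splits)
      then have "y \<in> Range \<beta>" using that(3,4) unfolding \<beta>_def by (auto simp: Range_iff colour_class_iff)
      then show False using P(1)[OF yP] by simp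
    qed
    show "i = j"
    proof (cases "(i = i0 \<and> x \<in> X) \<or> (j = i0 \<and> x' \<in> X)")
      case True
      then show ?thesis using mixed[of x j x'] mixed[of x' i x] new * i j by metis
    next
      case False
      then have o: "c' i x = (if x \<in> F then sw (c i x) else c i x)"
        "c' j x' = (if x' \<in> F then sw (c j x') else c j x')" using old by auto
      \<comment> \<open>For the colours \<open>a\<close> and \<open>b\<close>, both edges are
        swapped or neither is, according to whether their common right endpoint \<open>y\<close>
        lies in \<open>Y\<close>.\<close>
      have "c i x = c j x' \<and> c i x < n"
      proof (cases "c' i x = a \<or> c' i x = b")
        case True
        then have "c i x = a \<or> c i x = b" "c j x' = a \<or> c j x' = b"
          using o * unfolding sw_def by (auto split: if_splits)
        then have "x \<in> F \<longleftrightarrow> x' \<in> F" using FY i j * by metis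
        then show ?thesis using o * sw_inj sw_less by (auto split: if_splits)
      next
        case False
        then show ?thesis using o * unfolding sw_def by (auto split: if_splits)
      qed
      then show ?thesis using properD(3)[OF c i j] * by blast
    qed
  qed
  moreover have "uncoloured c' i = uncoloured c i - (if i = i0 then X else {})" for i
    using a sw_less by (auto simp: uncoloured_def c'_def)
  ultimately show ?thesis unfolding X_def by blast
qed

section \<open>Nearly optimal colourings\<close>

definition uncoloured_mass :: "(nat \<Rightarrow> 'a \<Rightarrow> nat) \<Rightarrow> real" where
  "uncoloured_mass c = (\<Sum>i<k. measure M (uncoloured c i))"

lemma augment_mass:
  assumes c: "proper c" and "a < n" "b < n" "i < k" "L > 0"
  shows "\<exists>c'. proper c' \<and> uncoloured_mass c' = uncoloured_mass c - measure M (augmentable c L i a b)"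
proof -
  let ?P = "augmentable c L i a b"
  let ?X = "(R i)\<inverse> `` ?P"
  obtain c' where c': "proper c'" "\<And>j. j < k \<Longrightarrow> uncoloured c' j = uncoloured c j - (if j = i then ?X else {})"
    using augment[OF assms] by blast
  have PM: "?P \<in> sets M" using assms by (intro augmentable_sets)
  have Ri: "R i \<in> pinj M E" by (rule R[OF assms(4)])
  have XM: "?X \<in> sets M" using pinjD(5)[OF Ri PM] .
  have "?P \<inter> Domain ((R i)\<inverse>) = ?P" unfolding augmentable_def by auto
  then have mX: "measure M ?X = measure M ?P"
    using measure_pinj_Image[OF pinj_converse[OF Ri] PM] by simp
  have "?X \<subseteq> uncoloured c i"
    using pinj_unique(2)[OF Ri] unfolding augmentable_def by blast
  then have "measure M (uncoloured c i - ?X) = measure M (uncoloured c i) - measure M ?P"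
    using mX finite_measure_Diff[OF uncoloured_sets[OF c assms(4)] XM] by simp
  then have "uncoloured_mass c' = (\<Sum>j<k. measure M (uncoloured c j) - (if j = i then measure M ?P else 0))"
    unfolding uncoloured_mass_def using c'(2) by (intro sum.cong) auto
  also have "\<dots> = uncoloured_mass c - measure M ?P"
    unfolding uncoloured_mass_def sum_subtractf using assms(4) by simp
  finally show ?thesis using c'(1) by blast
qed

text \<open>For some pair of free colours, the right endpoint of an uncoloured edge is augmentable
  or starts a path of at least \<open>L\<close> double steps. Starting points of the second kind lie
  outside the range of \<open>kempe\<close>, so \<open>wandering\<close> applies. The factor counts
  the members and the pairs of colours.\<close>

lemma uncoloured_mass_le:
  assumes c: "proper c" and L: "L > 0"
    and \<delta>: "\<And>i a b. i < k \<Longrightarrow> a < n \<Longrightarrow> b < n \<Longrightarrow> measure M (augmentable c L i a b) \<le> \<delta>"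
  shows "uncoloured_mass c \<le> real (k * n * n) * (\<delta> + 1 / real (Suc L))"
proof -
  define Q where "Q a b = (space M - Range (colour_class c b)) \<inter> Domain (kempe c a b ^^ L)" for a b
  have QM: "Q a b \<in> sets M" if "a < n" "b < n" for a b
    unfolding Q_def using that c colour_class_pinj kempe_pinj by (intro relpow_Domain) auto
  have Q: "measure M (Q a b) \<le> 1 / real (Suc L)" if ab: "a < n" "b < n" for a b
  proof -
    have "Q a b \<inter> Range (kempe c a b) = {}" unfolding Q_def kempe_def by auto
    then have "real (L + 1) * measure M (Q a b) \<le> 1"
      using wandering[OF kempe_pinj[OF c ab] QM[OF ab], of L] unfolding Q_def by auto
    then show ?thesis by (simp add: field_simps)
  qed
  have bound: "measure M (uncoloured c i) \<le> n * n * (\<delta> + 1 / real (Suc L))" if i: "i < k" for i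
  proof -
    note Ri = R[OF i]
    let ?S = "\<lambda>a b. (R i)\<inverse> `` (augmentable c L i a b \<union> Q a b)"
    have SM: "augmentable c L i a b \<union> Q a b \<in> sets M" if "a < n" "b < n" for a b
      using that QM augmentable_sets c i by auto
    then have SM': "?S a b \<in> sets M" if "a < n" "b < n" for a b
      using that pinjD(5)[OF Ri] by auto
    have S: "measure M (?S a b) \<le> \<delta> + 1 / real (Suc L)" if ab: "a < n" "b < n" for a b
    proof -
      have "measure M (?S a b) \<le> measure M (augmentable c L i a b \<union> Q a b)"
        using measure_pinj_Image[OF pinj_converse[OF Ri] SM[OF ab]] SM[OF ab]
        by (auto intro: finite_measure_mono)
      also have "\<dots> \<le> measure M (augmentable c L i a b) + measure M (Q a b)"
        using ab QM augmentable_sets c i by (intro measure_Un_le) auto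
      finally show ?thesis using \<delta>[OF i ab] Q[OF ab] by linarith
    qed
    have "uncoloured c i \<subseteq> (\<Union>a<n. \<Union>b<n. ?S a b)"
    proof
      fix x assume x: "x \<in> uncoloured c i"
      then obtain y where y: "(x, y) \<in> R i" unfolding uncoloured_def by auto
      obtain a where a: "a < n" "x \<notin> Domain (colour_class c a)" using missing_left[OF i x] by auto
      obtain b where b: "b < n" "y \<notin> Range (colour_class c b)" using missing_right[OF c i x y] by auto
      have "y \<in> space M" using y pinjD(1)[OF Ri] E_space by auto
      then have "y \<in> augmentable c L i a b \<union> Q a b"
        using x y a b unfolding augmentable_def Q_def by auto
      then have "x \<in> ?S a b" using y by blast
      then show "x \<in> (\<Union>a<n. \<Union>b<n. ?S a b)" using a b by blast
    qed
    then have "measure M (uncoloured c i) \<le> measure M (\<Union>a<n. \<Union>b<n. ?S a b)"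
      using SM' by (intro finite_measure_mono) auto
    also have "\<dots> \<le> (\<Sum>a<n. measure M (\<Union>b<n. ?S a b))"
      using SM' by (intro finite_measure_subadditive_finite) auto
    also have "\<dots> \<le> (\<Sum>a<n. \<Sum>b<n. measure M (?S a b))"
      using SM' by (intro sum_mono finite_measure_subadditive_finite) auto
    also have "\<dots> \<le> (\<Sum>a<n. \<Sum>b<n. \<delta> + 1 / real (Suc L))"
      using S by (intro sum_mono) auto
    finally show ?thesis by (simp add: algebra_simps)
  qed
  have "uncoloured_mass c \<le> (\<Sum>i<k. n * n * (\<delta> + 1 / real (Suc L)))"
    unfolding uncoloured_mass_def using bound by (intro sum_mono) auto
  then show ?thesis by (simp add: algebra_simps)
qed

text \<open>No iteration of augmentations is required: if the mass is within \<delta> of the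
  infimum, no single augmentation can gain more than \<delta>.\<close>

lemma almost_colouring:
  assumes "\<epsilon> > 0"
  shows "\<exists>c. proper c \<and> uncoloured_mass c < \<epsilon>"
proof -
  define I where "I = Inf (uncoloured_mass ` Collect proper)"
  \<comment> \<open>The constant \<open>n\<close> leaves every edge uncoloured.\<close>
  have "proper (\<lambda>_ _. n)" unfolding proper_def by auto
  then have ne: "uncoloured_mass ` Collect proper \<noteq> {}" by blast
  have nonneg: "uncoloured_mass c \<ge> 0" for c unfolding uncoloured_mass_def by (simp add: sum_nonneg)
  then have bdd: "bdd_below (uncoloured_mass ` Collect proper)" by (intro bdd_belowI[of _ 0]) auto
  \<comment> \<open>The summand 1 keeps \<open>K\<close> positive and makes the final estimate
    strict; \<delta> is chosen such that \<open>K * (\<delta> + \<delta>)\<close> is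
    \<epsilon>.\<close>
  define K where "K = real (k * n * n) + 1"
  have K: "K > 0" unfolding K_def by (simp add: add_nonneg_pos)
  define \<delta> where "\<delta> = \<epsilon> / (2 * K)"
  have \<delta>: "\<delta> > 0" unfolding \<delta>_def using assms K by simp
  obtain L :: nat where L: "1 / Suc L < \<delta>" "L > 0"
  proof -
    obtain L where "1 / Suc L < \<delta>" using nat_approx_posE[OF \<delta>] .
    moreover have "1 / real (Suc (Suc L)) \<le> 1 / real (Suc L)" by (simp add: frac_le)
    ultimately show thesis using that[of "Suc L"] by linarith
  qed
  obtain c where c: "proper c" "uncoloured_mass c < I + \<delta>"
    using cInf_lessD[OF ne, of "I + \<delta>"] \<delta> unfolding I_def by auto
  have "uncoloured_mass c \<le> real (k * n * n) * (\<delta> + 1 / real (Suc L))"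
  proof (rule uncoloured_mass_le[OF c(1) L(2)])
    fix i a b assume "i < k" "a < n" "b < n"
    then obtain c' where c': "proper c'" "uncoloured_mass c' = uncoloured_mass c - measure M (augmentable c L i a b)"
      using augment_mass[OF c(1) _ _ _ L(2)] by blast
    then have "I \<le> uncoloured_mass c'" unfolding I_def using bdd c'(1) by (intro cInf_lower imageI CollectI)
    then show "measure M (augmentable c L i a b) \<le> \<delta>" using c c' by linarith
  qed
  also have "\<dots> \<le> real (k * n * n) * (\<delta> + \<delta>)"
    using L by (intro mult_left_mono) auto
  also have "\<dots> < K * (\<delta> + \<delta>)" unfolding K_def using \<delta> by (simp add: algebra_simps)
  also have "\<dots> = \<epsilon>" unfolding \<delta>_def using K by (simp add: field_simps)
  finally show ?thesis using c by blast
qed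

section \<open>Counting coloured edges\<close>

lemma colour_class_Domain: "Domain (colour_class c a) = (\<Union>i<k. {x \<in> Domain (R i). c i x = a})"
  by (auto simp: colour_class_def)

text \<open>The coloured edges are counted once by colour and once by member.\<close>

lemma colour_class_mass:
  assumes c: "proper c"
  shows "(\<Sum>a<n. measure M (Domain (colour_class c a)))
    = (\<Sum>i<k. measure M (Domain (R i))) - uncoloured_mass c"
proof -
  let ?D = "\<lambda>i a. {x \<in> Domain (R i). c i x = a}"
  have DM: "?D i a \<in> sets M" if "i < k" "a < n" for i a using properD(1)[OF c that] .
  have "measure M (Domain (colour_class c a)) = (\<Sum>i<k. measure M (?D i a))" if a: "a < n" for a
    unfolding colour_class_Domain
  proof (rule finite_measure_finite_Union)
    show "disjoint_family_on (\<lambda>i. ?D i a) {..<k}"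
      unfolding disjoint_family_on_def using properD(2)[OF c] a by fastforce
  qed (use DM a in auto)
  then have "(\<Sum>a<n. measure M (Domain (colour_class c a))) = (\<Sum>i<k. \<Sum>a<n. measure M (?D i a))"
    by (simp add: sum.swap[of _ "{..<n}"])
  also have "(\<Sum>a<n. measure M (?D i a)) = measure M (Domain (R i)) - measure M (uncoloured c i)"
    if i: "i < k" for i
  proof -
    have "(\<Sum>a<n. measure M (?D i a)) = measure M (\<Union>a<n. ?D i a)"
      using DM i by (intro finite_measure_finite_Union[symmetric]) (auto simp: disjoint_family_on_def)
    also have "(\<Union>a<n. ?D i a) = Domain (R i) - uncoloured c i" by (auto simp: uncoloured_def)
    also have "measure M \<dots> = measure M (Domain (R i)) - measure M (uncoloured c i)"
      using R[OF i] uncoloured_sets[OF c i] by (intro finite_measure_Diff) (auto simp: uncoloured_def)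
    finally show ?thesis .
  qed
  then have "(\<Sum>i<k. \<Sum>a<n. measure M (?D i a)) = (\<Sum>i<k. measure M (Domain (R i)) - measure M (uncoloured c i))"
    by (intro sum.cong) auto
  finally show ?thesis by (simp add: sum_subtractf uncoloured_mass_def)
qed

text \<open>By properness at most one member contributes to the sum, so passing to the union loses
  no multiplicity.\<close>

lemma colour_class_indicator:
  assumes c: "proper c" and a: "a < n"
  shows "(indicator (colour_class c a) (x, y) :: real)
    = (\<Sum>i<k. indicator {(x, y). (x, y) \<in> R i \<and> c i x = a} (x, y))"
proof (cases "(x, y) \<in> colour_class c a")
  case True
  then obtain i where i: "i < k" "(x, y) \<in> R i" "c i x = a" by (auto simp: colour_class_iff)
  have "(indicator {(x, y). (x, y) \<in> R j \<and> c j x = a} (x, y) :: real) = (if j = i then 1 else 0)"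
    if "j < k" for j
  proof -
    have *: "j = i" if "(x, y) \<in> R j" "c j x = a"
      using properD(2)[OF c i(1) \<open>j < k\<close>, of x] i that a by (metis DomainI)
    show ?thesis
    proof (cases "j = i")
      case True
      then show ?thesis using i by simp
    next
      case False
      then have "(x, y) \<notin> {(x, y). (x, y) \<in> R j \<and> c j x = a}" using * by blast
      then show ?thesis using False by simp
    qed
  qed
  then have "(\<Sum>j<k. indicator {(x, y). (x, y) \<in> R j \<and> c j x = a} (x, y) :: real) = 1"
    using i(1) by simp
  then show ?thesis using True by simp
next
  case False
  then have "(\<Sum>i<k. indicator {(x, y). (x, y) \<in> R i \<and> c i x = a} (x, y) :: real) = 0"
    by (intro sum.neutral) (auto simp: colour_class_iff)
  then show ?thesis using False by simp
qed

end

section \<open>Almost decomposability\<close>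

locale standard_mp_equiv = polish_prob_space M T + mp_equiv M E for M :: "'a measure" and T E +
  assumes E_sets: "E \<in> sets (M \<Otimes>\<^sub>M M)"
begin

section \<open>Partial maps, relations and the counting measure\<close>

lemma pinj_pair_sets: "R \<in> pinj M E \<Longrightarrow> R \<in> sets (M \<Otimes>\<^sub>M M)"
  using E_space pinjD by (intro single_valued_sets) blast+

lemma full_pseudogroup_vimage:
  assumes \<phi>: "\<phi> \<in> full_pseudogroup M E" and S: "S \<in> sets M"
  shows "(Map.graph \<phi>)\<inverse> `` S \<in> sets M"
proof -
  let ?f = "\<lambda>x. the (\<phi> x)"
  have A: "dom \<phi> \<in> sets M" and f: "?f \<in> measurable (restrict_space M (dom \<phi>)) M"
    using \<phi> by (auto simp: full_pseudogroup_def measurable_restrict_space2_iff)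
  have "?f -` S \<inter> space (restrict_space M (dom \<phi>)) \<in> sets (restrict_space M (dom \<phi>))"
    using f S by (rule measurable_sets)
  moreover have "?f -` S \<inter> space (restrict_space M (dom \<phi>)) = (Map.graph \<phi>)\<inverse> `` S"
    using sets.sets_into_space[OF A] by (force simp: space_restrict_space Map.graph_def)
  ultimately show ?thesis using A by (simp add: sets_restrict_space_iff)
qed

lemma single_valued_graph: "single_valued (Map.graph \<phi>)"
  by (auto simp: single_valued_def Map.graph_def)

lemma full_pseudogroup_graph_sets:
  assumes \<phi>: "\<phi> \<in> full_pseudogroup M E"
  shows "Map.graph \<phi> \<in> sets (M \<Otimes>\<^sub>M M)"
proof (rule single_valued_sets[OF single_valued_graph])
  show "Map.graph \<phi> \<subseteq> space M \<times> space M" using \<phi> E_space by (auto simp: full_pseudogroup_def)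
qed (rule full_pseudogroup_vimage[OF \<phi>])

text \<open>Restricting the map to the set \<open>D\<close> of \<open>conull_bimeasurable\<close>
  makes images measurable too, at the cost of a null set of the domain.\<close>

lemma conull_pinj:
  assumes \<phi>: "\<phi> \<in> full_pseudogroup M E"
  shows "\<exists>R\<in>pinj M E. R \<subseteq> Map.graph \<phi> \<and> dom \<phi> - Domain R \<in> null_sets M"
proof -
  let ?f = "\<lambda>x. the (\<phi> x)"
  have A: "dom \<phi> \<in> sets M" and f: "?f \<in> measurable (restrict_space M (dom \<phi>)) M"
    and inj: "inj_on \<phi> (dom \<phi>)" and sub: "Map.graph \<phi> \<subseteq> E"
    using \<phi> by (auto simp: full_pseudogroup_def measurable_restrict_space2_iff)
  have "inj_on ?f (dom \<phi>)"
  proof (rule inj_onI)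
    fix x y assume *: "x \<in> dom \<phi>" "y \<in> dom \<phi>" "?f x = ?f y"
    then have "\<phi> x = \<phi> y" by (auto simp: dom_def)
    then show "x = y" using inj * by (auto dest: inj_onD)
  qed
  from conull_bimeasurable[OF A f this] obtain D where D: "D \<in> sets M" "D \<subseteq> dom \<phi>"
    "measure M (dom \<phi> - D) = 0" "\<And>C. C \<in> sets M \<Longrightarrow> ?f ` (C \<inter> D) \<in> sets M" by blast
  define R where "R = {(x, y). x \<in> D \<and> \<phi> x = Some y}"
  have R: "R \<subseteq> Map.graph \<phi>" unfolding R_def Map.graph_def by auto
  have "R \<in> pinj M E"
    unfolding pinj_def
  proof (intro CollectI conjI ballI)
    show "R \<subseteq> E" using R sub by blast
    show "single_valued R" by (auto simp: R_def single_valued_def)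
    show "single_valued (R\<inverse>)"
      using inj D(2) by (auto simp: R_def single_valued_def inj_on_def subset_iff dom_def)
    fix S assume S: "S \<in> sets M"
    have "R `` S = ?f ` (S \<inter> D)" using D(2) by (force simp: R_def)
    then show "R `` S \<in> sets M" using D(4)[OF S] by simp
    have "R\<inverse> `` S = (Map.graph \<phi>)\<inverse> `` S \<inter> D" by (auto simp: R_def Map.graph_def)
    then show "R\<inverse> `` S \<in> sets M" using full_pseudogroup_vimage[OF \<phi> S] D(1) by simp
  qed
  moreover have "Domain R = D" using D(2) by (force simp: R_def)
  then have "dom \<phi> - Domain R \<in> null_sets M" using A D by (auto simp: emeasure_eq_measure)
  ultimately show ?thesis using R by blast
qed

lemma sets_rel_measure: "G \<in> sets (M \<Otimes>\<^sub>M M) \<Longrightarrow> G \<subseteq> E \<Longrightarrow> G \<in> sets (rel_measure M E)"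
  unfolding rel_measure_def by (subst sets_measure_of) auto

text \<open>
  Only the inequality is claimed, since \<^const>\<open>rel_measure\<close> would be zero if the counting function
  were not countably additive; this saves proving the Lusin--Novikov theorem.
\<close>

lemma emeasure_rel_measure_le:
  assumes G: "G \<subseteq> E" "single_valued G" and S: "S \<in> sets M" "Domain G \<subseteq> S"
  shows "emeasure (rel_measure M E) G \<le> emeasure M S"
proof -
  have "emeasure (rel_measure M E) G \<le> (\<integral>\<^sup>+x. emeasure (count_space UNIV) (G \<inter> ({x} \<times> space M)) \<partial>M)"
    unfolding rel_measure_def emeasure_measure_of_conv by auto
  also have "\<dots> \<le> (\<integral>\<^sup>+x. indicator S x \<partial>M)"
  proof (rule nn_integral_mono)
    fix x
    show "emeasure (count_space UNIV) (G \<inter> ({x} \<times> space M)) \<le> (indicator S x :: ennreal)"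
    proof (cases "\<exists>y. (x, y) \<in> G")
      case True
      then obtain y where y: "(x, y) \<in> G" ..
      then have "G \<inter> ({x} \<times> space M) \<subseteq> {(x, y)}" using G(2) by (auto dest: single_valuedD)
      then have "emeasure (count_space UNIV) (G \<inter> ({x} \<times> space M)) \<le> emeasure (count_space UNIV) {(x, y)}"
        by (intro emeasure_mono) auto
      then show ?thesis using y S(2) by (auto simp: indicator_def)
    next
      case False
      then have "G \<inter> ({x} \<times> space M) = {}" by auto
      then show ?thesis by simp
    qed
  qed
  finally show ?thesis using S(1) by simp
qed

lemma almost_decomposable:
  fixes \<epsilon> :: real
  assumes \<Phi>: "doubly_stochastic M E n \<Phi>" and \<epsilon>: "\<epsilon> > 0"
  shows "\<exists>\<Psi>. decomposable_dse M E n \<Psi> \<and> dse_dist M E \<Phi> \<Psi> < ennreal \<epsilon>"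
proof -
  define k where "k = length \<Phi>"
  define g where "g i = Map.graph (\<Phi> ! i)" for i
  have n: "n \<ge> 1" using \<Phi> by (simp add: doubly_stochastic_def)
  have pg: "\<Phi> ! i \<in> full_pseudogroup M E" if "i < k" for i
    using \<Phi> nth_mem[of i \<Phi>] that unfolding doubly_stochastic_def k_def by blast
  have sum_nth: "(\<Sum>\<phi>\<leftarrow>\<Phi>. f \<phi>) = (\<Sum>i<k. f (\<Phi> ! i))" for f :: "('a \<rightharpoonup> 'a) \<Rightarrow> nat"
    by (simp add: sum_list_sum_nth k_def atLeast0LessThan)
  have AE1: "AE x in M. (\<Sum>i<k. indicator (dom (\<Phi> ! i)) x) = n"
    and AE2: "AE x in M. (\<Sum>i<k. indicator (ran (\<Phi> ! i)) x) = n"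
    using \<Phi> by (simp_all add: doubly_stochastic_def sum_nth)
  obtain N1 where N1: "N1 \<in> null_sets M"
    "\<And>x. x \<in> space M - N1 \<Longrightarrow> (\<Sum>i<k. indicator (dom (\<Phi> ! i)) x) = n"
    using AE_E3[OF AE1] by metis
  obtain N2 where N2: "N2 \<in> null_sets M"
    "\<And>x. x \<in> space M - N2 \<Longrightarrow> (\<Sum>i<k. indicator (ran (\<Phi> ! i)) x) = n"
    using AE_E3[OF AE2] by metis
  have "\<forall>i. \<exists>R. i < k \<longrightarrow> R \<in> pinj M E \<and> R \<subseteq> g i \<and> dom (\<Phi> ! i) - Domain R \<in> null_sets M"
    using conull_pinj[OF pg] unfolding g_def by blast
  then obtain R0 where R0: "\<And>i. i < k \<Longrightarrow> R0 i \<in> pinj M E" "\<And>i. i < k \<Longrightarrow> R0 i \<subseteq> g i"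
     "\<And>i. i < k \<Longrightarrow> dom (\<Phi> ! i) - Domain (R0 i) \<in> null_sets M" by metis
  \<comment> \<open>Discarding the exceptional null sets on both sides turns the almost sure degree
    conditions into bounds at every point.\<close>
  define R where "R i = R0 i \<inter> ((space M - N1) \<times> (space M - N2))" for i
  have R: "R i \<in> pinj M E" if "i < k" for i
    unfolding R_def using R0(1)[OF that] N1(1) N2(1) by (intro pinj_restrict) auto
  have Rg: "R i \<subseteq> g i" if "i < k" for i using R0(2)[OF that] unfolding R_def by blast
  have dom_sets: "dom (\<Phi> ! i) \<in> sets M" if "i < k" for i
    using pg[OF that] by (simp add: full_pseudogroup_def)
  have DR: "dom (\<Phi> ! i) - Domain (R i) \<in> null_sets M" if i: "i < k" for i
  proof -
    have N2s: "N2 \<in> sets M" using N2(1) by auto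
    have "measure M ((R0 i)\<inverse> `` N2) \<le> measure M N2"
      unfolding measure_pinj_Image[OF pinj_converse[OF R0(1)[OF i]] N2s]
      using N2s by (intro finite_measure_mono) auto
    moreover have "measure M N2 = 0" using N2(1) by (simp add: measure_eq_0_null_sets)
    ultimately have "measure M ((R0 i)\<inverse> `` N2) = 0" by (simp add: measure_le_0_iff)
    then have "(R0 i)\<inverse> `` N2 \<in> null_sets M"
      using pinjD(5)[OF R0(1)[OF i] N2s] by (intro null_setsI) (simp_all add: emeasure_eq_measure)
    then have "(dom (\<Phi> ! i) - Domain (R0 i)) \<union> N1 \<union> (R0 i)\<inverse> `` N2 \<in> null_sets M"
      using R0(3)[OF i] N1(1) by auto
    moreover have "dom (\<Phi> ! i) - Domain (R i)
        \<subseteq> (dom (\<Phi> ! i) - Domain (R0 i)) \<union> N1 \<union> (R0 i)\<inverse> `` N2"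
      using pinjD(1)[OF R0(1)[OF i]] E_space unfolding R_def by blast
    moreover have "dom (\<Phi> ! i) - Domain (R i) \<in> sets M" using R[OF i] dom_sets[OF i] by simp
    ultimately show ?thesis by (metis null_sets_subset)
  qed
  have count: "(\<Sum>i<k. indicator (S i) x) = card {i. i < k \<and> x \<in> S i}" for S :: "nat \<Rightarrow> 'a set" and x
    by (simp add: indicator_def sum_of_bool_eq Int_def)
  interpret edge_colouring M E R k n
  proof unfold_locales
    show "R i \<in> pinj M E" if "i < k" for i by (rule R[OF that])
    fix x
    show "card {i. i < k \<and> x \<in> Domain (R i)} \<le> n"
    proof (cases "x \<in> space M - N1")
      case True
      have "{i. i < k \<and> x \<in> Domain (R i)} \<subseteq> {i. i < k \<and> x \<in> dom (\<Phi> ! i)}"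
        using Rg by (auto simp: g_def Map.graph_def)
      then have "card {i. i < k \<and> x \<in> Domain (R i)} \<le> card {i. i < k \<and> x \<in> dom (\<Phi> ! i)}"
        by (intro card_mono) auto
      then show ?thesis using N1(2)[OF True] count by metis
    next
      case False
      then have "{i. i < k \<and> x \<in> Domain (R i)} = {}" unfolding R_def by blast
      then show ?thesis by (metis card.empty zero_le)
    qed
    show "card {i. i < k \<and> x \<in> Range (R i)} \<le> n"
    proof (cases "x \<in> space M - N2")
      case True
      have "{i. i < k \<and> x \<in> Range (R i)} \<subseteq> {i. i < k \<and> x \<in> ran (\<Phi> ! i)}"
        using Rg by (auto simp: g_def Map.graph_def ran_def)
      then have "card {i. i < k \<and> x \<in> Range (R i)} \<le> card {i. i < k \<and> x \<in> ran (\<Phi> ! i)}"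
        by (intro card_mono) auto
      then show ?thesis using N2(2)[OF True] count by metis
    next
      case False
      then have "{i. i < k \<and> x \<in> Range (R i)} = {}" unfolding R_def by blast
      then show ?thesis by (metis card.empty zero_le)
    qed
  qed
  \<comment> \<open>The uncoloured mass is paid twice: for the lost edges, and for the edges that
    \<theta> adds in their place.\<close>
  obtain c where c: "proper c" and mass: "uncoloured_mass c < \<epsilon> / 2"
    using almost_colouring[of "\<epsilon> / 2"] \<epsilon> by auto
  define \<alpha> where "\<alpha> a = colour_class c a" for a
  have \<alpha>: "\<alpha> a \<in> pinj M E" if "a < n" for a unfolding \<alpha>_def using c that by (rule colour_class_pinj)
  \<comment> \<open>Integrating the degree condition: the domains have total mass \<open>n\<close>,
    and shrinking to \<open>R i\<close> loses only null sets.\<close>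
  have total: "(\<Sum>i<k. measure M (Domain (R i))) = n"
  proof -
    have "(\<Sum>i<k. measure M (Domain (R i))) = (\<Sum>i<k. measure M (dom (\<Phi> ! i)))"
    proof (rule sum.cong)
      fix i assume "i \<in> {..<k}"
      then have i: "i < k" by simp
      have "Domain (R i) = dom (\<Phi> ! i) - (dom (\<Phi> ! i) - Domain (R i))"
        using Rg[OF i] unfolding g_def Map.graph_def by auto
      then show "measure M (Domain (R i)) = measure M (dom (\<Phi> ! i))"
        using measure_Diff_null_set[OF dom_sets[OF i] DR[OF i]] by metis
    qed simp
    also have "\<dots> = (\<Sum>i<k. \<integral>x. indicator (dom (\<Phi> ! i)) x \<partial>M)"
      using dom_sets by (intro sum.cong) (auto simp: Int_absorb2 sets.sets_into_space)
    also have "\<dots> = (\<integral>x. (\<Sum>i<k. indicator (dom (\<Phi> ! i)) x) \<partial>M)"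
      using dom_sets by (intro Bochner_Integration.integral_sum[symmetric]) (auto simp: emeasure_eq_measure)
    also have "\<dots> = (\<integral>x. real n \<partial>M)"
    proof (rule integral_cong_AE)
      show "AE x in M. (\<Sum>i<k. indicator (dom (\<Phi> ! i)) x) = real n"
        using AE1
      proof eventually_elim
        case (elim x)
        then have "real (\<Sum>i<k. indicator (dom (\<Phi> ! i)) x) = real n" by simp
        then show ?case by (simp add: indicator_def)
      qed
    qed (use dom_sets in auto)
    finally show ?thesis by (simp add: prob_space)
  qed
  have "\<forall>a. \<exists>\<theta> N. a < n \<longrightarrow> \<theta> \<in> pinj M E \<and> Domain \<theta> = space M \<and> Range \<theta> = space M \<and>
      N \<in> null_sets M \<and> (\<forall>x y. (x, y) \<in> \<alpha> a \<and> x \<notin> N \<longrightarrow> (x, y) \<in> \<theta>)"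
    using extend_to_full[OF \<alpha>] by blast
  then obtain \<theta> N where \<theta>N: "\<forall>a. a < n \<longrightarrow> \<theta> a \<in> pinj M E \<and> Domain (\<theta> a) = space M \<and>
      Range (\<theta> a) = space M \<and> N a \<in> null_sets M \<and>
      (\<forall>x y. (x, y) \<in> \<alpha> a \<and> x \<notin> N a \<longrightarrow> (x, y) \<in> \<theta> a)"
    unfolding choice_iff by blast
  then have \<theta>: "\<And>a. a < n \<Longrightarrow> \<theta> a \<in> pinj M E" "\<And>a. a < n \<Longrightarrow> Domain (\<theta> a) = space M"
    "\<And>a. a < n \<Longrightarrow> Range (\<theta> a) = space M" "\<And>a. a < n \<Longrightarrow> N a \<in> null_sets M"
    "\<And>a x y. a < n \<Longrightarrow> (x, y) \<in> \<alpha> a \<Longrightarrow> x \<notin> N a \<Longrightarrow> (x, y) \<in> \<theta> a" by simp_all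
  define \<Psi> where "\<Psi> = map (\<lambda>a. rel_map (\<theta> a)) [0..<n]"
  have sv: "single_valued (\<theta> a)" if "a < n" for a using pinjD(2)[OF \<theta>(1)[OF that]] .
  have sum_\<Psi>: "(\<Sum>\<phi>\<leftarrow>\<Psi>. f \<phi>) = (\<Sum>a<n. f (rel_map (\<theta> a)))" for f :: "('a \<rightharpoonup> 'a) \<Rightarrow> nat"
    unfolding \<Psi>_def by (simp add: sum_list_sum_nth atLeast0LessThan)
  have \<Psi>_matrix: "dse_matrix \<Psi> z = (\<Sum>a<n. indicator (\<theta> a) z)" for z
    unfolding dse_matrix_def sum_\<Psi> using sv by (intro sum.cong) (auto simp: graph_rel_map)
  have \<Psi>: "decomposable_dse M E n \<Psi>"
    unfolding decomposable_dse_def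
  proof (intro conjI)
    have "(\<Sum>\<phi>\<leftarrow>\<Psi>. indicator (dom \<phi>) x) = n" "(\<Sum>\<phi>\<leftarrow>\<Psi>. indicator (ran \<phi>) x) = n"
      if "x \<in> space M" for x
      using that \<theta>(2,3) sv by (simp_all add: sum_\<Psi> dom_rel_map ran_rel_map)
    then show "doubly_stochastic M E n \<Psi>"
      using n rel_map_pinj[OF \<theta>(1)] by (auto simp: doubly_stochastic_def \<Psi>_def)
    \<comment> \<open>Colours run from \<open>0\<close> to \<open>n - 1\<close>, a decomposition
      from \<open>1\<close> to \<open>n\<close>.\<close>
    define \<theta>' where "\<theta>' j = rel_map (\<theta> (j - 1))" for j :: nat
    have "\<theta>' j \<in> full_group M E" if "j \<in> {1..n}" for j
    proof -
      have "j - 1 < n" using that by auto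
      then show ?thesis
        using rel_map_pinj[OF \<theta>(1)] \<theta>(2,3) sv
        by (simp add: full_group_def \<theta>'_def dom_rel_map ran_rel_map)
    qed
    moreover have "dse_matrix \<Psi> z = (\<Sum>j = 1..n. indicator (Map.graph (\<theta>' j)) z)" for z
    proof -
      have "(\<Sum>j = 1..n. indicator (Map.graph (\<theta>' j)) z) = (\<Sum>a<n. indicator (Map.graph (\<theta>' (Suc a))) z :: nat)"
        using sum.shift_bounds_Suc_ivl[of "\<lambda>j. indicator (Map.graph (\<theta>' j)) z" 0 n]
        by (simp add: atLeastLessThanSuc_atLeastAtMost atLeast0LessThan)
      also have "\<dots> = dse_matrix \<Psi> z"
        unfolding \<Psi>_matrix using sv by (intro sum.cong) (auto simp: \<theta>'_def graph_rel_map)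
      finally show ?thesis by simp
    qed
    ultimately show "\<exists>\<theta>. (\<forall>j\<in>{1..n}. \<theta> j \<in> full_group M E) \<and>
        (AE z in rel_measure M E. dse_matrix \<Psi> z = (\<Sum>j = 1..n. indicator (Map.graph (\<theta> j)) z))"
      by (intro exI[of _ \<theta>']) simp
  qed
  \<comment> \<open>The four sources of error: \<open>G\<close> edges lost with null sets,
    \<open>H\<close> uncoloured edges, \<open>P\<close> coloured edges not kept by the extension,
    \<open>Q\<close> edges added by it. \<open>G\<close> and \<open>P\<close> turn out to be
    null.\<close>
  define G where "G i = g i - R i" for i
  define H where "H i = R i \<inter> (uncoloured c i \<times> space M)" for i
  define P where "P a = \<alpha> a - \<theta> a" for a
  define Q where "Q a = \<theta> a - \<alpha> a" for a
  have \<Phi>_matrix: "real (dse_matrix \<Phi> z) =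
      (\<Sum>i<k. indicator (G i) z + indicator (H i) z) + (\<Sum>a<n. indicator (\<alpha> a) z)" for z
  proof -
    obtain x y where z: "z = (x, y)" by (cases z)
    let ?C = "\<lambda>i a. {(x, y). (x, y) \<in> R i \<and> c i x = a}"
    \<comment> \<open>An edge of a member is lost, uncoloured, or has exactly one colour.\<close>
    have split: "indicator (g i) z = indicator (G i) z + indicator (H i) z + (\<Sum>a<n. indicator (?C i a) z :: real)"
      if i: "i < k" for i
    proof (cases "z \<in> R i \<and> c i x < n")
      case True
      then have "(\<Sum>a<n. indicator (?C i a) z :: real) = (\<Sum>a<n. if a = c i x then 1 else 0)"
        by (intro sum.cong) (auto simp: z indicator_def)
      also have "\<dots> = 1" using True by simp
      finally show ?thesis
        using True Rg[OF i] by (auto simp: indicator_def G_def H_def uncoloured_def z)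
    next
      case False
      then have "(\<Sum>a<n. indicator (?C i a) z :: real) = 0"
        by (intro sum.neutral) (auto simp: z indicator_def)
      moreover have "z \<in> R i \<Longrightarrow> z \<in> H i"
        using False pinjD(1)[OF R[OF i]] E_space by (auto simp: H_def uncoloured_def z)
      ultimately show ?thesis
        using Rg[OF i] by (auto simp: indicator_def G_def H_def)
    qed
    have "real (dse_matrix \<Phi> z) = (\<Sum>i<k. indicator (g i) z)"
      unfolding dse_matrix_def sum_nth by (simp add: g_def indicator_def)
    also have "\<dots> = (\<Sum>i<k. indicator (G i) z + indicator (H i) z) + (\<Sum>i<k. \<Sum>a<n. indicator (?C i a) z)"
      using split by (simp add: sum.distrib)
    also have "(\<Sum>i<k. \<Sum>a<n. indicator (?C i a) z :: real) = (\<Sum>a<n. \<Sum>i<k. indicator (?C i a) z)"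
      by (rule sum.swap)
    also have "\<dots> = (\<Sum>a<n. indicator (\<alpha> a) z)"
      unfolding \<alpha>_def z using colour_class_indicator[OF c] by (intro sum.cong) auto
    finally show ?thesis .
  qed
  have diff: "\<bar>real (dse_matrix \<Phi> z) - real (dse_matrix \<Psi> z)\<bar> \<le>
      (\<Sum>i<k. indicator (G i) z + indicator (H i) z) + (\<Sum>a<n. indicator (P a) z + indicator (Q a) z)" for z
  proof -
    have "real (dse_matrix \<Psi> z) = (\<Sum>a<n. indicator (\<theta> a) z)"
      unfolding \<Psi>_matrix by (simp add: indicator_def)
    then have "real (dse_matrix \<Phi> z) - real (dse_matrix \<Psi> z) =
      (\<Sum>i<k. indicator (G i) z + indicator (H i) z) + (\<Sum>a<n. indicator (\<alpha> a) z - indicator (\<theta> a) z)"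
      by (simp add: \<Phi>_matrix sum_subtractf)
    moreover have "\<bar>\<Sum>i<k. indicator (G i) z + indicator (H i) z :: real\<bar> = (\<Sum>i<k. indicator (G i) z + indicator (H i) z)"
      by (intro abs_of_nonneg sum_nonneg) auto
    moreover have "\<bar>\<Sum>a<n. indicator (\<alpha> a) z - indicator (\<theta> a) z :: real\<bar> \<le> (\<Sum>a<n. indicator (P a) z + indicator (Q a) z)"
      by (rule order_trans[OF sum_abs], rule sum_mono) (auto simp: indicator_def P_def Q_def)
    ultimately show ?thesis by linarith
  qed
  have g_sets: "g i \<in> sets (M \<Otimes>\<^sub>M M)" and gE: "g i \<subseteq> E" if "i < k" for i
    unfolding g_def using full_pseudogroup_graph_sets pg[OF that] by (auto simp: full_pseudogroup_def)
  have U: "uncoloured c i \<in> sets M" if "i < k" for i using uncoloured_sets[OF c that] .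
  have H_pinj: "H i \<in> pinj M E" if "i < k" for i
    unfolding H_def using R U that by (intro pinj_restrict) auto
  have pinj_rel_sets: "S \<in> sets (rel_measure M E)" if "S \<in> pinj M E" for S
    using pinj_pair_sets[OF that] pinjD(1)[OF that] by (rule sets_rel_measure)
  have sets: "i < k \<Longrightarrow> G i \<in> sets (rel_measure M E)" "i < k \<Longrightarrow> H i \<in> sets (rel_measure M E)"
    "a < n \<Longrightarrow> P a \<in> sets (rel_measure M E)" "a < n \<Longrightarrow> Q a \<in> sets (rel_measure M E)" for i a
    using pinj_rel_sets R \<alpha> \<theta>(1) H_pinj sets_rel_measure[OF g_sets gE]
    by (simp_all add: G_def P_def Q_def sets.Diff)
  have G: "emeasure (rel_measure M E) (G i) = 0" if i: "i < k" for i
  proof -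
    have "Domain (G i) \<subseteq> dom (\<Phi> ! i) - Domain (R i)"
      using Rg[OF i] unfolding G_def g_def Map.graph_def by fastforce
    then have "emeasure (rel_measure M E) (G i) \<le> emeasure M (dom (\<Phi> ! i) - Domain (R i))"
      using gE[OF i] DR[OF i] single_valued_graph[of "\<Phi> ! i"]
      by (intro emeasure_rel_measure_le) (auto simp: G_def g_def intro: single_valued_subset)
    then show ?thesis using DR[OF i] by auto
  qed
  have H: "emeasure (rel_measure M E) (H i) \<le> ennreal (measure M (uncoloured c i))" if i: "i < k" for i
  proof -
    have "emeasure (rel_measure M E) (H i) \<le> emeasure M (uncoloured c i)"
      using pinjD(1,2)[OF H_pinj[OF i]] U[OF i]
      by (intro emeasure_rel_measure_le) (auto simp: H_def)
    then show ?thesis by (simp add: emeasure_eq_measure)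
  qed
  have P: "emeasure (rel_measure M E) (P a) = 0" if a: "a < n" for a
  proof -
    have "Domain (P a) \<subseteq> N a" using \<theta>(5)[OF a] unfolding P_def by blast
    then have "emeasure (rel_measure M E) (P a) \<le> emeasure M (N a)"
      using pinjD(1,2)[OF \<alpha>[OF a]] \<theta>(4)[OF a]
      by (intro emeasure_rel_measure_le) (auto simp: P_def intro: single_valued_subset)
    then show ?thesis using \<theta>(4)[OF a] by auto
  qed
  have Q: "emeasure (rel_measure M E) (Q a) \<le> ennreal (1 - measure M (Domain (\<alpha> a)))" if a: "a < n" for a
  proof -
    \<comment> \<open>Since \<open>\<theta> a\<close> is single valued and agrees with
      \<open>\<alpha> a\<close> off \<open>N a\<close>, it adds edges only over points where
      \<open>\<alpha> a\<close> is undefined, up to \<open>N a\<close>.\<close>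
    have "Domain (Q a) \<subseteq> (space M - Domain (\<alpha> a)) \<union> N a"
      using \<theta>(5)[OF a] \<theta>(2)[OF a] single_valuedD[OF sv[OF a]] unfolding Q_def by blast
    then have "emeasure (rel_measure M E) (Q a) \<le> emeasure M ((space M - Domain (\<alpha> a)) \<union> N a)"
      using pinjD(1,2)[OF \<theta>(1)[OF a]] \<theta>(4)[OF a] \<alpha>[OF a]
      by (intro emeasure_rel_measure_le) (auto simp: Q_def intro: single_valued_subset)
    also have "\<dots> = emeasure M (space M - Domain (\<alpha> a))"
      using \<theta>(4)[OF a] \<alpha>[OF a] by (intro emeasure_Un_null_set) auto
    also have "\<dots> = ennreal (1 - measure M (Domain (\<alpha> a)))"
      using \<alpha>[OF a] by (simp add: emeasure_eq_measure prob_compl)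
    finally show ?thesis .
  qed
  have "dse_dist M E \<Phi> \<Psi> \<le> (\<integral>\<^sup>+z. (\<Sum>i<k. indicator (G i) z + indicator (H i) z)
      + (\<Sum>a<n. indicator (P a) z + indicator (Q a) z) \<partial>rel_measure M E)"
    unfolding dse_dist_def
  proof (rule nn_integral_mono)
    fix z
    have "ennreal \<bar>real (dse_matrix \<Phi> z) - real (dse_matrix \<Psi> z)\<bar> \<le>
      ennreal ((\<Sum>i<k. indicator (G i) z + indicator (H i) z) + (\<Sum>a<n. indicator (P a) z + indicator (Q a) z))"
      by (rule ennreal_leI[OF diff])
    also have "\<dots> = (\<Sum>i<k. indicator (G i) z + indicator (H i) z) + (\<Sum>a<n. indicator (P a) z + indicator (Q a) z)"
      by (simp add: ennreal_plus sum_nonneg flip: sum_ennreal ennreal_indicator)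
    finally show "ennreal \<bar>real (dse_matrix \<Phi> z) - real (dse_matrix \<Psi> z)\<bar> \<le> \<dots>" .
  qed
  also have "\<dots> = (\<Sum>i<k. emeasure (rel_measure M E) (G i) + emeasure (rel_measure M E) (H i))
      + (\<Sum>a<n. emeasure (rel_measure M E) (P a) + emeasure (rel_measure M E) (Q a))"
  proof -
    have sum: "(\<integral>\<^sup>+z. (\<Sum>i<m. indicator (A i) z + indicator (B i) z) \<partial>L)
        = (\<Sum>i<m. emeasure L (A i) + emeasure L (B i))"
      if "\<And>i. i < m \<Longrightarrow> A i \<in> sets L" "\<And>i. i < m \<Longrightarrow> B i \<in> sets L"
      for L :: "('a \<times> 'a) measure" and A B and m :: nat
      using that by (subst nn_integral_sum) (auto simp: nn_integral_add intro!: sum.cong)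
    have meas: "(\<lambda>z. \<Sum>i<m. indicator (A i) z + indicator (B i) z :: ennreal) \<in> borel_measurable L"
      if "\<And>i. i < m \<Longrightarrow> A i \<in> sets L" "\<And>i. i < m \<Longrightarrow> B i \<in> sets L"
      for L :: "('a \<times> 'a) measure" and A B and m :: nat
      using that by (intro borel_measurable_sum borel_measurable_add borel_measurable_indicator) auto
    show ?thesis
      using sets by (simp add: nn_integral_add meas sum)
  qed
  also have "\<dots> \<le> (\<Sum>i<k. ennreal (measure M (uncoloured c i))) + (\<Sum>a<n. ennreal (1 - measure M (Domain (\<alpha> a))))"
    using G H P Q by (intro add_mono sum_mono) auto
  also have "\<dots> = ennreal (uncoloured_mass c + (\<Sum>a<n. 1 - measure M (Domain (\<alpha> a))))"
    by (simp add: uncoloured_mass_def sum_nonneg ennreal_plus)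
  \<comment> \<open>The domains of the colour classes have total mass \<open>n\<close> minus the
    uncoloured mass, so their deficits add up to the uncoloured mass.\<close>
  also have "(\<Sum>a<n. 1 - measure M (Domain (\<alpha> a))) = uncoloured_mass c"
    using colour_class_mass[OF c] total by (simp add: sum_subtractf \<alpha>_def)
  also have "ennreal (uncoloured_mass c + uncoloured_mass c) < ennreal \<epsilon>"
    using mass \<epsilon> by (intro ennreal_lessI) auto
  finally show ?thesis using \<Psi> by blast
qed

end

theorem theorem3p9:
  fixes M :: "'a measure" and E :: "('a \<times> 'a) set"
    and n :: nat and \<Phi> :: "('a \<rightharpoonup> 'a) list" and \<epsilon> :: real
  assumes "standard_prob_space M"
    and "countable_borel_equiv_rel M E"
    and "measure_preserving_rel M E"
    and "doubly_stochastic M E n \<Phi>"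
    and "\<epsilon> > 0"
  shows "\<exists>\<Psi>. decomposable_dse M E n \<Psi> \<and> dse_dist M E \<Phi> \<Psi> < ennreal \<epsilon>"
proof -
  obtain T where T: "prob_space M" "completely_metrizable_space T" "second_countable T"
    "topspace T = space M" "sets M = sigma_sets (space M) {U. openin T U}"
    using assms(1) unfolding standard_prob_space_def by blast
  interpret prob_space M by fact
  interpret standard_mp_equiv M T E
    using T assms(2,3) by unfold_locales (auto simp: countable_borel_equiv_rel_def)
  show ?thesis using assms(4,5) by (rule almost_decomposable)
qed

end
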